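(* Fix an integer $\nu\ge 1$. Let $P$ and $N\le P^2$ be sufficiently large positive integers, and suppose that for every prime $p$ with $P<p\le 2P$ we are given an integer $N_p$ with $N<N_p\le 2N$. For each prime $p$ let $\mathcal{X}_p^*$ be the set of primitive multiplicative (Dirichlet) characters modulo $p^2$. Then $$ \sum_{\substack{P<p\le 2P\\ p\ \text{prime}}}\ \max_{\chi\in\mathcal{X}_p^*}\left|\sum_{n=1}^{N_p}\chi(n)\right|^{2\nu}\le \left(P^3+N^\nu+\min\{N^\nu P^{1/2},\,N^{\nu/2}P^2\}\right)N^\nu P^{o(1)} $$ as $P\to\infty$, for any such sequence $(N_p)$. Here $o(1)$ denotes a quantity that tends to $0$ as $P\to\infty$ for fixed $\nu$, uniformly over $N\le P^2$ and over the choice of the $N_p$. *)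

theory Defs
  imports Complex_Main "HOL-Number_Theory.Number_Theory"
begin

text \<open>Dirichlet characters modulo \<open>m\<close> are viewed as functions on the integers, extended by zero to
  the integers not coprime to \<open>m\<close>.\<close>

definition dirichlet_character :: "nat \<Rightarrow> (int \<Rightarrow> complex) \<Rightarrow> bool" where
  "dirichlet_character m \<chi> \<longleftrightarrow>
     (\<forall>a b. \<chi> (a * b) = \<chi> a * \<chi> b) \<and>
     (\<forall>a. \<chi> (a + int m) = \<chi> a) \<and>
     (\<forall>a. \<chi> a \<noteq> 0 \<longleftrightarrow> coprime a (int m))"

definition induced_modulus :: "nat \<Rightarrow> (int \<Rightarrow> complex) \<Rightarrow> nat \<Rightarrow> bool" where
  "induced_modulus m \<chi> d \<longleftrightarrow>
     d dvd m \<and> (\<forall>a. coprime a (int m) \<and> [a = 1] (mod int d) \<longrightarrow> \<chi> a = 1)"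

definition primitive_characters :: "nat \<Rightarrow> (int \<Rightarrow> complex) set" where
  "primitive_characters m =
     {\<chi>. dirichlet_character m \<chi> \<and> (\<forall>d<m. \<not> induced_modulus m \<chi> d)}"

end

theory Submission
  imports Defs "HOL-Analysis.Convex" "HOL-Library.Real_Mod" "HOL-Library.Disjoint_Sets"
begin

text \<open>Since only one character \<open>\<chi>\<^sub>p\<close> occurs for each prime \<open>p\<close>, no large sieve for square moduli
  is needed. For \<open>p \<noteq> r\<close> the product of \<open>\<chi>\<^sub>p\<close> and the conjugate of \<open>\<chi>\<^sub>r\<close> is primitive modulo \<open>p\<^sup>2 r\<^sup>2\<close>,
  so its sums over intervals are \<open>O(P\<^sup>2 log P)\<close> by Polya--Vinogradov, and Halasz--Montgomery duality
  bounds \<open>\<Sum>\<^sub>p \<bar>\<Sum>\<^sub>n\<^sub>\<le>\<^sub>M a\<^sub>n \<chi>\<^sub>p(n)\<bar>\<^sup>2\<close> by \<open>(M + O(P\<^sup>3 log P)) \<Sum> \<bar>a\<^sub>n\<bar>\<^sup>2\<close>. The \<open>\<nu>\<close>-th power of a character sum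
  has this shape with \<open>M\<close> of order \<open>N\<^sup>\<nu>\<close> and \<open>a\<^sub>n\<close> at most a power of the divisor function; the lengths
  \<open>N\<^sub>p\<close> are made independent of \<open>p\<close> by a dyadic decomposition. All losses are powers of \<open>log P\<close>.\<close>

subsection \<open>Additive and Dirichlet characters\<close>

definition add_char :: "nat \<Rightarrow> int \<Rightarrow> complex" where
  "add_char q x = cis (2 * pi * of_int x / of_nat q)"

lemma add_char_add: "add_char q (x + y) = add_char q x * add_char q y"
  by (simp add: add_char_def cis_mult add_divide_distrib distrib_left)

lemma norm_add_char [simp]: "norm (add_char q x) = 1"
  by (simp add: add_char_def)

lemma cnj_add_char: "cnj (add_char q x) = add_char q (- x)"
  by (simp add: add_char_def cis_cnj)

lemma add_char_mult_nat: "add_char q (x * int n) = add_char q x ^ n"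
  by (simp add: add_char_def DeMoivre mult_ac)

lemma add_char_eq_1_iff:
  assumes "q > 0"
  shows "add_char q x = 1 \<longleftrightarrow> int q dvd x"
proof -
  have "add_char q x = 1 \<longleftrightarrow> (\<exists>n. 2 * pi * of_int x / of_nat q = of_int n * (2 * pi))"
    by (simp add: add_char_def cis_eq_1_iff)
  also have "\<dots> \<longleftrightarrow> (\<exists>n. real_of_int x = real_of_int (int q * n))"
    using assms by (intro ex_cong1) (auto simp: field_simps)
  also have "\<dots> \<longleftrightarrow> int q dvd x"
    by (simp only: of_int_eq_iff dvd_def)
  finally show ?thesis .
qed

lemma add_char_cong:
  assumes "q > 0" "[x = y] (mod int q)"
  shows "add_char q x = add_char q y"
proof -
  have "add_char q (x - y) = 1"
    using assms by (simp add: add_char_eq_1_iff cong_iff_dvd_diff)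
  thus ?thesis
    using add_char_add[of q "x - y" y] by simp
qed

lemma sum_int_lessThan: "(\<Sum>h\<in>{0..<int q}. f h) = (\<Sum>h<q. f (int h))"
  by (rule sum.reindex_bij_witness[of _ int nat]) auto

lemma sum_add_char:
  assumes "q > 0"
  shows "(\<Sum>h\<in>{0..<int q}. add_char q (x * h)) = (if int q dvd x then of_nat q else 0)"
proof (cases "int q dvd x")
  case True
  hence "add_char q (x * h) = 1" for h
    using assms by (simp add: add_char_eq_1_iff)
  thus ?thesis using True by simp
next
  case False
  have "add_char q x ^ q = 1"
    using assms by (simp flip: add_char_mult_nat add: add_char_eq_1_iff)
  moreover have "add_char q x \<noteq> 1"
    using False assms by (simp add: add_char_eq_1_iff)
  ultimately show ?thesis
    using False by (simp add: sum_int_lessThan add_char_mult_nat sum_gp_strict)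
qed

text \<open>Multiplication by a unit permutes the residues. The map \<open>g\<close> is that
  permutation with representatives reduced to the standard range; injectivity on a finite set gives
  surjectivity.\<close>

lemma sum_residues_mult:
  assumes "q > 0" "coprime c (int q)" and per: "\<And>a b. [a = b] (mod int q) \<Longrightarrow> F a = F b"
  shows "(\<Sum>a\<in>{0..<int q}. F (c * a)) = (\<Sum>a\<in>{0..<int q}. F a)"
proof -
  let ?R = "{0..<int q}"
  define g where "g = (\<lambda>a. (c * a) mod int q)"
  have inj: "inj_on g ?R"
  proof (rule inj_onI)
    fix a b assume ab: "a \<in> ?R" "b \<in> ?R" "g a = g b"
    hence "[c * a = c * b] (mod int q)" by (simp add: g_def cong_def)
    hence "[a = b] (mod int q)" using assms(2) by (simp add: cong_mult_lcancel)
    thus "a = b" using ab cong_less_imp_eq_int[of a "int q" b] by auto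
  qed
  have "g ` ?R \<subseteq> ?R" using assms(1) by (auto simp: g_def)
  hence im: "g ` ?R = ?R" by (rule endo_inj_surj[OF _ _ inj, rotated]) simp
  have "(\<Sum>a\<in>?R. F (c * a)) = (\<Sum>a\<in>?R. F (g a))"
    by (intro sum.cong refl per) (simp add: g_def cong_def)
  also have "\<dots> = (\<Sum>a\<in>g ` ?R. F a)"
    by (simp add: sum.reindex[OF inj])
  finally show ?thesis by (simp add: im)
qed

section \<open>Elementary properties of Dirichlet characters extended by zero\<close>

lemma dirichlet_character_cong:
  assumes "dirichlet_character m \<chi>" "[a = b] (mod int m)"
  shows "\<chi> a = \<chi> b"
proof -
  have per: "\<chi> (x + int m * int k) = \<chi> x" for x k
  proof (induction k)
    case (Suc k)
    have "\<chi> (x + int m * int (Suc k)) = \<chi> ((x + int m * int k) + int m)"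
      by (simp add: algebra_simps)
    also have "\<dots> = \<chi> (x + int m * int k)"
      using assms(1) unfolding dirichlet_character_def by blast
    finally show ?case using Suc by simp
  qed simp
  obtain k where k: "b = a + int m * k"
    using assms(2) by (auto simp: cong_iff_lin)
  show ?thesis
  proof (cases "k \<ge> 0")
    case True
    thus ?thesis using k per[of a "nat k"] by simp
  next
    case False
    thus ?thesis using k per[of b "nat (- k)"] by simp
  qed
qed

lemma dirichlet_character_mult: "dirichlet_character m \<chi> \<Longrightarrow> \<chi> (a * b) = \<chi> a * \<chi> b"
  by (simp add: dirichlet_character_def)

lemma dirichlet_character_eq_0_iff: "dirichlet_character m \<chi> \<Longrightarrow> \<chi> a = 0 \<longleftrightarrow> \<not> coprime a (int m)"
  unfolding dirichlet_character_def by blast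

lemma dirichlet_character_1:
  assumes "dirichlet_character m \<chi>"
  shows "\<chi> 1 = 1"
  using dirichlet_character_mult[OF assms, of 1 1] dirichlet_character_eq_0_iff[OF assms, of 1] by simp

lemma dirichlet_character_power:
  assumes "dirichlet_character m \<chi>"
  shows "\<chi> (a ^ k) = \<chi> a ^ k"
  by (induction k) (simp_all add: dirichlet_character_1[OF assms] dirichlet_character_mult[OF assms])

lemma dirichlet_character_prod:
  assumes "dirichlet_character m \<chi>"
  shows "\<chi> (\<Prod>i\<in>A. f i) = (\<Prod>i\<in>A. \<chi> (f i))"
  by (induction A rule: infinite_finite_induct)
     (simp_all add: dirichlet_character_1[OF assms] dirichlet_character_mult[OF assms])

lemma dirichlet_character_root_of_unity:
  assumes "dirichlet_character m \<chi>" "m > 0" "coprime a (int m)"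
  shows "\<chi> a ^ totient m = 1"
proof -
  define b where "b = nat (a mod int m)"
  have b: "int b = a mod int m" using assms(2) by (simp add: b_def)
  hence ab: "[a = int b] (mod int m)" by (simp add: cong_def)
  hence "coprime (int b) (int m)" using assms(3) cong_imp_coprime by blast
  hence "[b ^ totient m = 1] (mod m)" by (intro euler_theorem) simp
  hence "[int b ^ totient m = 1] (mod int m)"
    by (simp flip: cong_int_iff)
  moreover have "[a ^ totient m = int b ^ totient m] (mod int m)" using ab by (rule cong_pow)
  ultimately have "[a ^ totient m = 1] (mod int m)" using cong_trans by blast
  from dirichlet_character_cong[OF assms(1) this] show ?thesis
    by (simp add: dirichlet_character_power[OF assms(1)] dirichlet_character_1[OF assms(1)])
qed

lemma norm_dirichlet_character:
  assumes "dirichlet_character m \<chi>" "m > 0"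
  shows "norm (\<chi> a) = (if coprime a (int m) then 1 else 0)"
proof (cases "coprime a (int m)")
  case True
  from dirichlet_character_root_of_unity[OF assms True] have "norm (\<chi> a) ^ totient m = 1"
    by (metis norm_one norm_power)
  hence "norm (\<chi> a) = 1"
    using assms(2) by (intro power_eq_imp_eq_base[of _ "totient m" 1]) auto
  thus ?thesis using True by simp
next
  case False
  thus ?thesis using dirichlet_character_eq_0_iff[OF assms(1), of a] by simp
qed

lemma norm_dirichlet_character_le_1:
  assumes "dirichlet_character m \<chi>" "m > 0"
  shows "norm (\<chi> a) \<le> 1"
  using norm_dirichlet_character[OF assms, of a] by (simp split: if_splits)

text \<open>A character is determined by its restriction to one residue system, where each value is
  0 or a root of unity of order dividing \<open>totient m\<close>. Finiteness is what makes the
  maximum over primitive characters an attained value.\<close>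

lemma finite_dirichlet_characters:
  assumes "m > 0"
  shows "finite {\<chi>. dirichlet_character m \<chi>}"
proof (rule inj_on_finite)
  let ?r = "\<lambda>\<chi>. restrict \<chi> {0..<int m}"
  let ?Z = "insert 0 {z::complex. z ^ totient m = 1}"
  show "inj_on ?r {\<chi>. dirichlet_character m \<chi>}"
  proof (rule inj_onI, rule ext)
    fix \<chi> \<psi> :: "int \<Rightarrow> complex" and a
    assume *: "\<chi> \<in> {\<chi>. dirichlet_character m \<chi>}" "\<psi> \<in> {\<chi>. dirichlet_character m \<chi>}" "?r \<chi> = ?r \<psi>"
    have "\<chi> (a mod int m) = \<psi> (a mod int m)"
      using fun_cong[OF *(3), of "a mod int m"] assms by (simp split: if_splits)
    moreover have "[a = a mod int m] (mod int m)" by (simp add: cong_def)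
    moreover have "\<chi> a = \<chi> (a mod int m)" "\<psi> a = \<psi> (a mod int m)"
      using *(1,2) \<open>[a = a mod int m] (mod int m)\<close> by (auto intro: dirichlet_character_cong)
    ultimately show "\<chi> a = \<psi> a" by simp
  qed
  show "?r ` {\<chi>. dirichlet_character m \<chi>} \<subseteq> PiE {0..<int m} (\<lambda>_. ?Z)"
  proof (rule image_subsetI)
    fix \<chi> assume "\<chi> \<in> {\<chi>. dirichlet_character m \<chi>}"
    hence char: "dirichlet_character m \<chi>" by simp
    have "\<chi> a \<in> ?Z" for a
      using dirichlet_character_root_of_unity[OF char assms, of a] dirichlet_character_eq_0_iff[OF char, of a]
      by blast
    thus "?r \<chi> \<in> PiE {0..<int m} (\<lambda>_. ?Z)" by (simp add: restrict_PiE_iff)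
  qed
  show "finite (PiE {0..<int m} (\<lambda>_. ?Z))"
    using assms finite_roots_unity[of "totient m", where 'a = complex]
    by (simp add: finite_PiE Suc_le_eq)
qed

lemma finite_primitive_characters: "m > 0 \<Longrightarrow> finite (primitive_characters m)"
  by (rule finite_subset[OF _ finite_dirichlet_characters[of m]]) (auto simp: primitive_characters_def)

lemma primitive_character_witness:
  assumes "\<chi> \<in> primitive_characters m" "d dvd m" "d \<noteq> m" "m > 0"
  obtains c where "coprime c (int m)" "[c = 1] (mod int d)" "\<chi> c \<noteq> 1"
proof -
  have "d < m" using dvd_imp_le[OF assms(2,4)] assms(3) by simp
  hence "\<not> induced_modulus m \<chi> d" using assms(1) by (simp add: primitive_characters_def)
  thus ?thesis using assms(2) that by (auto simp: induced_modulus_def)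
qed

text \<open>A primitive character is \<open>\<chi>(a) = e(q(a)/p)\<close> with the Fermat quotient \<open>q(a)\<close>; the latter is a
  homomorphism to \<open>\<int>/p\<close> because \<open>(xy - 1) - (x - 1) - (y - 1) = (x - 1)(y - 1)\<close>, and it does not
  vanish at \<open>1 + p\<close>.\<close>

lemma primitive_characters_prime_square_nonempty:
  assumes p: "prime p"
  shows "primitive_characters (p ^ 2) \<noteq> {}"
proof -
  \<comment> \<open>By Fermat, \<open>a ^ (p - 1) - 1\<close> is \<open>p\<close> times the Fermat
    quotient, so the additive character modulo \<open>p ^ 2\<close> evaluates to e(q(a)/p).\<close>
  define \<chi> where "\<chi> = (\<lambda>a. if coprime a (int p) then add_char (p ^ 2) (a ^ (p - 1) - 1) else 0)"
  have p1: "p > 1" using p prime_gt_1_nat by blast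
  have dvd: "int p dvd a ^ (p - 1) - 1" if "coprime a (int p)" for a
  proof -
    define b where "b = nat (a mod int p)"
    have b: "int b = a mod int p" using p1 by (simp add: b_def)
    hence ab: "[a = int b] (mod int p)" by (simp add: cong_def)
    hence "coprime (int b) (int p)" using that cong_imp_coprime by blast
    hence "[b ^ totient p = 1] (mod p)" by (intro euler_theorem) simp
    hence "[int b ^ (p - 1) = 1] (mod int p)"
      using p by (simp flip: cong_int_iff add: totient_prime)
    moreover have "[a ^ (p - 1) = int b ^ (p - 1)] (mod int p)" using ab by (rule cong_pow)
    ultimately show ?thesis using cong_trans cong_iff_dvd_diff by blast
  qed
  have mult: "\<chi> (a * b) = \<chi> a * \<chi> b" for a b
  proof (cases "coprime a (int p) \<and> coprime b (int p)")
    case True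
    let ?x = "a ^ (p - 1)" and ?y = "b ^ (p - 1)"
    have "int p * int p dvd (?x - 1) * (?y - 1)" using True dvd by (intro mult_dvd_mono) auto
    also have "(?x - 1) * (?y - 1) = ((a * b) ^ (p - 1) - 1) - ((?x - 1) + (?y - 1))"
      by (simp add: power_mult_distrib algebra_simps)
    finally have "[(a * b) ^ (p - 1) - 1 = (?x - 1) + (?y - 1)] (mod int (p ^ 2))"
      by (simp add: cong_iff_dvd_diff power2_eq_square)
    hence "add_char (p ^ 2) ((a * b) ^ (p - 1) - 1) = add_char (p ^ 2) ((?x - 1) + (?y - 1))"
      using p1 by (intro add_char_cong) auto
    thus ?thesis using True unfolding \<chi>_def add_char_add by simp
  qed (auto simp: \<chi>_def)
  have add_char_ne_0: "add_char q x \<noteq> 0" for q x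
    using norm_add_char[of q x] by (metis norm_zero zero_neq_one)
  have char: "dirichlet_character (p ^ 2) \<chi>"
    unfolding dirichlet_character_def
  proof (intro conjI allI)
    fix a :: int
    have co: "coprime (a + int (p ^ 2)) (int p) \<longleftrightarrow> coprime a (int p)"
      by (rule coprime_cong_cong_left) (simp add: cong_def power2_eq_square)
    have "[(a + int (p ^ 2)) ^ (p - 1) - 1 = a ^ (p - 1) - 1] (mod int (p ^ 2))"
      by (intro cong_diff cong_pow cong_refl) (simp add: cong_def)
    hence "add_char (p ^ 2) ((a + int (p ^ 2)) ^ (p - 1) - 1) = add_char (p ^ 2) (a ^ (p - 1) - 1)"
      using p1 by (intro add_char_cong) auto
    thus "\<chi> (a + int (p ^ 2)) = \<chi> a" using co unfolding \<chi>_def by simp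
    show "\<chi> a \<noteq> 0 \<longleftrightarrow> coprime a (int (p ^ 2))"
      using add_char_ne_0 by (simp add: \<chi>_def)
  qed (rule mult)
  have "\<not> induced_modulus (p ^ 2) \<chi> d" if "d < p ^ 2" for d
  proof
    assume ind: "induced_modulus (p ^ 2) \<chi> d"
    hence "d dvd p ^ 2" by (simp add: induced_modulus_def)
    then obtain i where i: "i \<le> 2" "d = p ^ i" using divides_primepow_nat[OF p] by blast
    with that have "i \<noteq> 2" by auto
    \<comment> \<open>A proper divisor of \<open>p ^ 2\<close> divides \<open>p\<close>, so the
      single element \<open>1 + p\<close> tests every candidate modulus \<open>d\<close> at
      once.\<close>
    with i have "d dvd p ^ 1" using le_imp_power_dvd[of i 1 p] by simp
    hence 1: "[1 + int p = 1] (mod int d)" by (simp add: cong_iff_dvd_diff)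
    have "[1 + int p = 1] (mod int p)" by (simp add: cong_iff_dvd_diff)
    from coprime_cong_cong_left[OF this] have 2: "coprime (1 + int p) (int p)"
      by (simp only: coprime_1_left)
    have "\<chi> (1 + int p) = 1" using ind 1 2 unfolding induced_modulus_def by simp
    hence "int (p ^ 2) dvd (1 + int p) ^ (p - 1) - 1"
      using 2 p1 by (simp add: \<chi>_def add_char_eq_1_iff)
    \<comment> \<open>The binomial expansion to first order; at \<open>k = p - 1\<close> it would
      force \<open>p\<close> to divide \<open>p - 1\<close>.\<close>
    moreover have "int (p ^ 2) dvd (1 + int p) ^ k - 1 - int k * int p" for k
    proof (induction k)
      case (Suc k)
      have "(1 + int p) ^ Suc k - 1 - int (Suc k) * int p =
        (1 + int p) * ((1 + int p) ^ k - 1 - int k * int p) + int (p ^ 2) * int k"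
        by (simp add: algebra_simps power2_eq_square)
      thus ?case using Suc by (simp only: dvd_add dvd_mult dvd_triv_left)
    qed simp
    ultimately have "int (p ^ 2) dvd int (p - 1) * int p"
      using dvd_diff_right_iff by blast
    hence "p ^ 2 dvd (p - 1) * p" by (simp only: int_dvd_int_iff flip: of_nat_mult)
    hence "p dvd p - 1" using p1 by (simp add: power2_eq_square)
    thus False using p1 by (auto dest: dvd_imp_le)
  qed
  with char have "\<chi> \<in> primitive_characters (p ^ 2)" by (simp add: primitive_characters_def)
  thus ?thesis by blast
qed

subsection \<open>Gauss sums and the Polya--Vinogradov inequality\<close>

text \<open>The finite Fourier transform of an arbitrary function \<chi>; inversion and Parseval
  below hold at this generality, and only the later size bounds require a character.\<close>

definition gauss_sum :: "nat \<Rightarrow> (int \<Rightarrow> complex) \<Rightarrow> int \<Rightarrow> complex" where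
  "gauss_sum q \<chi> h = (\<Sum>a\<in>{0..<int q}. \<chi> a * add_char q (a * h))"

lemma gauss_sum_mult_coprime:
  assumes "dirichlet_character q \<chi>" "q > 0" "coprime c (int q)"
  shows "gauss_sum q \<chi> h = \<chi> c * gauss_sum q \<chi> (c * h)"
proof -
  have "gauss_sum q \<chi> h = (\<Sum>a\<in>{0..<int q}. \<chi> (c * a) * add_char q (c * a * h))"
    unfolding gauss_sum_def using assms(2,3)
  proof (rule sum_residues_mult[symmetric])
    fix a b assume ab: "[a = b] (mod int q)"
    hence "[a * h = b * h] (mod int q)" by (rule cong_scalar_right)
    thus "\<chi> a * add_char q (a * h) = \<chi> b * add_char q (b * h)"
      using add_char_cong[OF assms(2)] dirichlet_character_cong[OF assms(1) ab] by simp
  qed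
  also have "\<dots> = \<chi> c * gauss_sum q \<chi> (c * h)"
    by (simp add: gauss_sum_def sum_distrib_left dirichlet_character_mult[OF assms(1)] mult_ac)
  finally show ?thesis .
qed

text \<open>Let g = gcd(h, q) > 1 and d = q/g. Primitivity supplies a unit c = 1 (mod d) with
  \<chi>(c) different from 1. Then ch = h (mod q), so the Gauss sum at h equals \<chi>(c) times
  itself and must vanish.\<close>

lemma gauss_sum_not_coprime:
  assumes "\<chi> \<in> primitive_characters q" "q > 0" "\<not> coprime h (int q)"
  shows "gauss_sum q \<chi> h = 0"
proof -
  have char: "dirichlet_character q \<chi>" using assms(1) by (simp add: primitive_characters_def)
  define g where "g = nat (gcd h (int q))"
  have g: "int g = gcd h (int q)" by (simp add: g_def)
  have "g \<noteq> 1" using assms(3) g by (auto simp: coprime_iff_gcd_eq_1)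
  have "g dvd q" by (simp flip: int_dvd_int_iff add: g)
  then obtain d where d: "q = g * d" by (auto simp: dvd_def)
  have "d \<noteq> q" using d \<open>g \<noteq> 1\<close> assms(2) by auto
  then obtain c where c: "coprime c (int q)" "[c = 1] (mod int d)" "\<chi> c \<noteq> 1"
    using primitive_character_witness[OF assms(1) _ _ assms(2), of d] d by auto
  have "int g * int d dvd h * (c - 1)"
    using c(2) g by (intro mult_dvd_mono) (auto simp: cong_iff_dvd_diff)
  hence "[c * h = h] (mod int q)"
    by (simp add: cong_iff_dvd_diff d algebra_simps)
  hence "[a * (c * h) = a * h] (mod int q)" for a by (rule cong_scalar_left)
  hence "gauss_sum q \<chi> (c * h) = gauss_sum q \<chi> h"
    unfolding gauss_sum_def by (intro sum.cong refl arg_cong2[where f = times] add_char_cong assms(2))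
  with gauss_sum_mult_coprime[OF char assms(2) c(1), of h] c(3) show ?thesis
    by (metis mult_cancel_right1)
qed

lemma fourier_inversion_mod:
  assumes "q > 0" "a \<in> {0..<int q}"
  shows "(\<Sum>h\<in>{0..<int q}. gauss_sum q \<chi> h * add_char q (- (a * h))) = of_nat q * \<chi> a"
proof -
  let ?R = "{0..<int q}"
  have "(\<Sum>h\<in>?R. gauss_sum q \<chi> h * add_char q (- (a * h)))
      = (\<Sum>h\<in>?R. \<Sum>b\<in>?R. \<chi> b * add_char q ((b - a) * h))"
    unfolding gauss_sum_def sum_distrib_right mult.assoc add_char_add[symmetric]
    by (simp add: algebra_simps)
  also have "\<dots> = (\<Sum>b\<in>?R. \<chi> b * (\<Sum>h\<in>?R. add_char q ((b - a) * h)))"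
    by (subst sum.swap) (simp add: sum_distrib_left)
  also have "\<dots> = (\<Sum>b\<in>?R. if b = a then of_nat q * \<chi> a else 0)"
  proof (intro sum.cong refl)
    fix b assume b: "b \<in> ?R"
    have "int q dvd b - a \<longleftrightarrow> b = a"
      using b assms(2) by (auto simp flip: cong_iff_dvd_diff simp: cong_less_imp_eq_int)
    thus "\<chi> b * (\<Sum>h\<in>?R. add_char q ((b - a) * h)) = (if b = a then of_nat q * \<chi> a else 0)"
      using sum_add_char[OF assms(1)] by auto
  qed
  also have "\<dots> = of_nat q * \<chi> a" using assms(2) by simp
  finally show ?thesis .
qed

text \<open>Expanding only the conjugated factor and swapping sums leaves an inner sum that
  \<open>fourier_inversion_mod\<close> evaluates.\<close>

lemma parseval_mod:
  assumes "q > 0"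
  shows "(\<Sum>h\<in>{0..<int q}. norm (gauss_sum q \<chi> h) ^ 2) = real q * (\<Sum>a\<in>{0..<int q}. norm (\<chi> a) ^ 2)"
proof -
  let ?R = "{0..<int q}"
  have "complex_of_real (\<Sum>h\<in>?R. norm (gauss_sum q \<chi> h) ^ 2)
      = (\<Sum>h\<in>?R. gauss_sum q \<chi> h * cnj (gauss_sum q \<chi> h))"
    by (simp only: of_real_sum complex_norm_square)
  also have "\<dots> = (\<Sum>h\<in>?R. \<Sum>a\<in>?R. cnj (\<chi> a) * (gauss_sum q \<chi> h * add_char q (- (a * h))))"
    by (subst (2) gauss_sum_def) (simp add: sum_distrib_left cnj_add_char mult_ac)
  also have "\<dots> = (\<Sum>a\<in>?R. cnj (\<chi> a) * (\<Sum>h\<in>?R. gauss_sum q \<chi> h * add_char q (- (a * h))))"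
    by (subst sum.swap) (simp add: sum_distrib_left)
  also have "\<dots> = (\<Sum>a\<in>?R. of_nat q * (\<chi> a * cnj (\<chi> a)))"
    by (intro sum.cong refl) (simp add: fourier_inversion_mod[OF assms])
  also have "\<dots> = complex_of_real (real q * (\<Sum>a\<in>?R. norm (\<chi> a) ^ 2))"
    by (simp only: complex_norm_square[symmetric] of_real_mult of_real_sum sum_distrib_left of_real_of_nat_eq)
  finally show ?thesis by (simp only: of_real_eq_iff)
qed

text \<open>The modulus of the Gauss sum is the same at all units h, by
  \<open>gauss_sum_mult_coprime\<close>. Parseval over the units alone therefore bounds (number of
  units) * modulus^2 by q * (number of units), and the count cancels.\<close>

lemma norm_gauss_sum_le:
  assumes "\<chi> \<in> primitive_characters q" "q > 0"
  shows "norm (gauss_sum q \<chi> h) \<le> sqrt (real q)"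
proof (cases "coprime h (int q)")
  case False
  thus ?thesis using gauss_sum_not_coprime[OF assms] by simp
next
  case True
  have char: "dirichlet_character q \<chi>" using assms(1) by (simp add: primitive_characters_def)
  let ?R = "{0..<int q}"
  let ?C = "{a\<in>?R. coprime a (int q)}"
  have eq: "norm (gauss_sum q \<chi> c) = norm (gauss_sum q \<chi> 1)" if "coprime c (int q)" for c
    using gauss_sum_mult_coprime[OF char assms(2) that, of 1] norm_dirichlet_character[OF char assms(2), of c] that
    by (simp add: norm_mult)
  have "real (card ?C) * norm (gauss_sum q \<chi> h) ^ 2 = (\<Sum>c\<in>?C. norm (gauss_sum q \<chi> c) ^ 2)"
  proof -
    have "norm (gauss_sum q \<chi> c) ^ 2 = norm (gauss_sum q \<chi> h) ^ 2" if "c \<in> ?C" for c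
      using eq[OF True] eq[of c] that by simp
    hence "(\<Sum>c\<in>?C. norm (gauss_sum q \<chi> c) ^ 2) = (\<Sum>c\<in>?C. norm (gauss_sum q \<chi> h) ^ 2)"
      by (intro sum.cong refl)
    thus ?thesis by simp
  qed
  also have "\<dots> \<le> (\<Sum>c\<in>?R. norm (gauss_sum q \<chi> c) ^ 2)"
    by (intro sum_mono2) auto
  also have "\<dots> = real q * (\<Sum>a\<in>?R. norm (\<chi> a) ^ 2)" by (rule parseval_mod[OF assms(2)])
  also have "(\<Sum>a\<in>?R. norm (\<chi> a) ^ 2) = (\<Sum>a\<in>?R. if coprime a (int q) then 1 else 0)"
    by (intro sum.cong refl) (simp add: norm_dirichlet_character[OF char assms(2)])
  also have "\<dots> = real (card ?C)" by (subst sum.inter_filter[symmetric]) auto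
  finally have *: "real (card ?C) * norm (gauss_sum q \<chi> h) ^ 2 \<le> real (card ?C) * real q"
    by (simp add: mult_ac)
  have "h mod int q \<in> ?C" using True assms(2) by simp
  moreover have "finite ?C" by (rule finite_subset[of _ ?R]) auto
  ultimately have "card ?C > 0" by (auto simp: card_gt_0_iff)
  with * have "norm (gauss_sum q \<chi> h) ^ 2 \<le> real q" by simp
  thus ?thesis by (rule real_le_rsqrt)
qed

section \<open>Geometric sums of additive characters and the harmonic sum\<close>

lemma sin_pi_ge:
  assumes "0 \<le> x" "x \<le> 1 / 2"
  shows "2 * x \<le> sin (pi * x)"
proof -
  have "concave_on {0..pi} sin"
    by (rule f''_le0_imp_concave[where f' = cos and f'' = "\<lambda>x. - sin x"])
       (auto intro!: derivative_eq_intros simp: sin_ge_zero)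
  hence "sin ((1 - 2 * x) *\<^sub>R 0 + (2 * x) *\<^sub>R (pi / 2)) \<ge> (1 - 2 * x) * sin 0 + (2 * x) * sin (pi / 2)"
    using assms by (intro concave_onD) auto
  thus ?thesis by (simp add: mult.commute)
qed

text \<open>The parabola serves as a lower bound on the whole unit interval because 1/(x(1 - x)) =
  1/x + 1/(1 - x), which turns the geometric sum bound into two harmonic terms.\<close>

lemma sin_pi_ge_parabola:
  assumes "0 \<le> x" "x \<le> 1"
  shows "2 * x * (1 - x) \<le> sin (pi * x)"
proof (cases "x \<le> 1 / 2")
  case True
  have "2 * x * (1 - x) \<le> 2 * x * 1" using assms by (intro mult_left_mono) auto
  thus ?thesis using sin_pi_ge[of x] assms True by simp
next
  case False
  have "2 * x * (1 - x) = x * (2 * (1 - x))" by simp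
  also have "\<dots> \<le> 1 * (2 * (1 - x))" using assms by (intro mult_right_mono) auto
  also have "\<dots> \<le> sin (pi * (1 - x))" using sin_pi_ge[of "1 - x"] False assms by simp
  also have "\<dots> = sin (pi * x)" by (simp add: right_diff_distrib)
  finally show ?thesis .
qed

lemma norm_cis_minus_1: "norm (cis (2 * t) - 1) = 2 * \<bar>sin t\<bar>"
proof -
  have "(cos (2 * t) - 1)\<^sup>2 + (sin (2 * t))\<^sup>2 = (2 * sin t)\<^sup>2"
  proof -
    have "(cos (2 * t) - 1)\<^sup>2 + (sin (2 * t))\<^sup>2 = 2 - 2 * cos (2 * t)"
      using sin_cos_squared_add[of "2 * t"] by (simp add: power2_diff)
    also have "\<dots> = (2 * sin t)\<^sup>2"
      by (simp add: cos_double_sin power_mult_distrib)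
    finally show ?thesis .
  qed
  thus ?thesis by (simp add: cmod_def real_sqrt_mult)
qed

lemma norm_sum_add_char_le:
  assumes "0 < h" "h < int q"
  shows "norm (\<Sum>n<M. add_char q (- (int n * h))) \<le> real q / 2 * (1 / of_int h + 1 / (real q - of_int h))"
proof -
  have q: "q > 0" using assms by linarith
  define x where "x = real_of_int h / real q"
  have x: "0 < x" "x < 1" using assms q by (auto simp: x_def field_simps)
  define z where "z = add_char q (- h)"
  have "z \<noteq> 1" using assms q by (auto simp: z_def add_char_eq_1_iff dest: zdvd_imp_le)
  \<comment> \<open>Conjugation removes the minus sign in the frequency, so that
    \<open>norm_cis_minus_1\<close> applies with a positive angle.\<close>
  have "norm (z - 1) = norm (cnj (z - 1))" by (simp only: complex_mod_cnj)
  also have "\<dots> = norm (cis (2 * (pi * x)) - 1)" by (simp add: z_def add_char_def x_def cis_cnj mult.assoc)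
  also have "\<dots> = 2 * \<bar>sin (pi * x)\<bar>" by (rule norm_cis_minus_1)
  finally have nz: "norm (z - 1) \<ge> 2 * (2 * x * (1 - x))"
    using sin_pi_ge_parabola[of x] x by linarith
  have pos: "2 * (2 * x * (1 - x)) > 0" using x by simp
  have "(\<Sum>n<M. add_char q (- (int n * h))) = (\<Sum>n<M. z ^ n)"
    unfolding z_def add_char_mult_nat[symmetric] by (simp add: mult.commute)
  also have "\<dots> = (1 - z ^ M) / (1 - z)" using \<open>z \<noteq> 1\<close> by (simp add: sum_gp_strict)
  also have "norm \<dots> = norm (1 - z ^ M) / norm (z - 1)" by (simp add: norm_divide norm_minus_commute)
  also have "\<dots> \<le> 2 / (2 * (2 * x * (1 - x)))"
  proof (rule frac_le)
    show "norm (1 - z ^ M) \<le> 2"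
      using norm_triangle_ineq4[of 1 "z ^ M"] by (simp add: norm_power z_def)
  qed (use nz pos in auto)
  also have "\<dots> = real q / 2 * (1 / of_int h + 1 / (real q - of_int h))"
    using x q unfolding x_def by (simp add: field_simps)
  finally show ?thesis .
qed

lemma sum_inverse_le_ln:
  assumes "n > 0"
  shows "(\<Sum>k=1..n. 1 / real k) \<le> 1 + ln (real n)"
  using assms
proof (induction n rule: nat_induct_non_zero)
  case (Suc n)
  \<comment> \<open>The inequality ln t <= t - 1 at t = n/(n + 1) bounds 1/(n + 1) by a difference
    of logarithms, which telescopes.\<close>
  have "ln (real n / real (Suc n)) \<le> real n / real (Suc n) - 1"
    using Suc by (intro ln_le_minus_one) simp
  hence "1 / real (Suc n) \<le> ln (real (Suc n)) - ln (real n)"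
    using Suc by (simp add: ln_div field_simps del: of_nat_Suc)
  thus ?case using Suc.IH by simp
qed simp

text \<open>Expand \<chi> by Fourier inversion: each coefficient is at most sqrt q in modulus, and
  the incomplete sums of additive characters contribute two harmonic sums of length q - 1.\<close>

theorem polya_vinogradov:
  assumes "\<chi> \<in> primitive_characters q" "q > 1"
  shows "norm (\<Sum>n<M. \<chi> (int n)) \<le> sqrt (real q) * (1 + ln (real q))"
proof -
  have char: "dirichlet_character q \<chi>" using assms(1) by (simp add: primitive_characters_def)
  have q: "q > 0" using assms(2) by simp
  let ?R = "{0..<int q}"
  define E where "E = (\<lambda>h. \<Sum>n<M. add_char q (- (int n * h)))"
  have "of_nat q * \<chi> (int n) = (\<Sum>h\<in>?R. gauss_sum q \<chi> h * add_char q (- (int n * h)))" for n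
  proof -
    \<comment> \<open>Inversion is available only for representatives in \<open>{0..<int q}\<close>,
      so \<open>n\<close> is first reduced modulo \<open>q\<close>; both sides are periodic.\<close>
    have n: "[int n mod int q = int n] (mod int q)" by (simp add: cong_def)
    have "[- (int n mod int q * h) = - (int n * h)] (mod int q)" for h
      using cong_scalar_right[OF n, of h] by (simp add: cong_minus_minus_iff)
    hence "add_char q (- (int n mod int q * h)) = add_char q (- (int n * h))" for h
      by (intro add_char_cong[OF q])
    hence "(\<Sum>h\<in>?R. gauss_sum q \<chi> h * add_char q (- (int n * h)))
        = (\<Sum>h\<in>?R. gauss_sum q \<chi> h * add_char q (- (int n mod int q * h)))"
      by simp
    also have "\<dots> = of_nat q * \<chi> (int n mod int q)"
      using q by (intro fourier_inversion_mod) auto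
    finally show ?thesis using dirichlet_character_cong[OF char n] by simp
  qed
  hence "of_nat q * (\<Sum>n<M. \<chi> (int n)) = (\<Sum>n<M. \<Sum>h\<in>?R. gauss_sum q \<chi> h * add_char q (- (int n * h)))"
    by (simp add: sum_distrib_left)
  also have "\<dots> = (\<Sum>h\<in>?R. \<Sum>n<M. gauss_sum q \<chi> h * add_char q (- (int n * h)))"
    by (rule sum.swap)
  also have "\<dots> = (\<Sum>h\<in>?R. gauss_sum q \<chi> h * E h)"
    by (simp add: E_def sum_distrib_left)
  \<comment> \<open>The zero frequency, whose additive sum shows no cancellation, drops out: 0 is
    not coprime to q > 1, so its Gauss sum is 0.\<close>
  also have "\<dots> = (\<Sum>h\<in>{0<..<int q}. gauss_sum q \<chi> h * E h)"
  proof (rule sum.mono_neutral_right)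
    show "\<forall>h\<in>?R - {0<..<int q}. gauss_sum q \<chi> h * E h = 0"
    proof
      fix h assume "h \<in> ?R - {0<..<int q}"
      hence "h = 0" by auto
      moreover have "gauss_sum q \<chi> 0 = 0"
        using assms by (intro gauss_sum_not_coprime) auto
      ultimately show "gauss_sum q \<chi> h * E h = 0" by simp
    qed
  qed auto
  finally have "real q * norm (\<Sum>n<M. \<chi> (int n)) = norm (\<Sum>h\<in>{0<..<int q}. gauss_sum q \<chi> h * E h)"
    by (metis norm_mult norm_of_nat)
  also have "\<dots> \<le> (\<Sum>h\<in>{0<..<int q}. sqrt (real q) * (real q / 2 * (1 / of_int h + 1 / (real q - of_int h))))"
  proof (rule sum_norm_le)
    fix h assume "h \<in> {0<..<int q}"
    thus "norm (gauss_sum q \<chi> h * E h) \<le> sqrt (real q) * (real q / 2 * (1 / of_int h + 1 / (real q - of_int h)))"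
      unfolding norm_mult E_def
      by (intro mult_mono norm_gauss_sum_le[OF assms(1) q] norm_sum_add_char_le) simp_all
  qed
  also have "\<dots> = sqrt (real q) * (real q / 2) *
      ((\<Sum>h\<in>{0<..<int q}. 1 / of_int h) + (\<Sum>h\<in>{0<..<int q}. 1 / (real q - of_int h)))"
    by (simp only: sum.distrib[symmetric] sum_distrib_left mult.assoc)
  also have "\<dots> \<le> sqrt (real q) * (real q / 2) * ((1 + ln (real q)) + (1 + ln (real q)))"
  proof (intro mult_left_mono add_mono)
    have "(\<Sum>h\<in>{0<..<int q}. 1 / real_of_int h) = (\<Sum>k=1..q-1. 1 / real k)"
      by (rule sum.reindex_bij_witness[of _ int nat]) auto
    also have "\<dots> \<le> 1 + ln (real (q - 1))"
      using assms(2) by (intro sum_inverse_le_ln) auto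
    also have "\<dots> \<le> 1 + ln (real q)" using assms(2) by simp
    finally show *: "(\<Sum>h\<in>{0<..<int q}. 1 / real_of_int h) \<le> 1 + ln (real q)" .
    have "(\<Sum>h\<in>{0<..<int q}. 1 / (real q - of_int h)) = (\<Sum>h\<in>{0<..<int q}. 1 / real_of_int h)"
      by (rule sum.reindex_bij_witness[of _ "\<lambda>h. int q - h" "\<lambda>h. int q - h"]) auto
    with * show "(\<Sum>h\<in>{0<..<int q}. 1 / (real q - of_int h)) \<le> 1 + ln (real q)" by simp
  qed auto
  also have "\<dots> = real q * (sqrt (real q) * (1 + ln (real q)))"
    by (simp only: times_divide_eq_right mult.assoc mult.left_commute[of "real q"] flip: mult_2) simp
  finally show ?thesis using q by (simp only: mult_le_cancel_left_pos of_nat_0_less_iff)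
qed

subsection \<open>Products of primitive characters\<close>

lemma primitive_characters_cnj:
  assumes "\<chi> \<in> primitive_characters m"
  shows "(\<lambda>a. cnj (\<chi> a)) \<in> primitive_characters m"
  using assms unfolding primitive_characters_def dirichlet_character_def induced_modulus_def by simp

lemma dirichlet_character_times:
  assumes "dirichlet_character m \<chi>" "dirichlet_character n \<psi>"
  shows "dirichlet_character (m * n) (\<lambda>a. \<chi> a * \<psi> a)"
  unfolding dirichlet_character_def
proof (intro conjI allI)
  fix a b :: int
  show "\<chi> (a * b) * \<psi> (a * b) = \<chi> a * \<psi> a * (\<chi> b * \<psi> b)"
    by (simp add: dirichlet_character_mult[OF assms(1)] dirichlet_character_mult[OF assms(2)])
  have "\<chi> (a + int (m * n)) = \<chi> a" "\<psi> (a + int (m * n)) = \<psi> a"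
    using dirichlet_character_cong[OF assms(1), of "a + int (m * n)" a]
      dirichlet_character_cong[OF assms(2), of "a + int (m * n)" a]
    by (simp_all add: cong_def)
  thus "\<chi> (a + int (m * n)) * \<psi> (a + int (m * n)) = \<chi> a * \<psi> a" by simp
  show "\<chi> a * \<psi> a \<noteq> 0 \<longleftrightarrow> coprime a (int (m * n))"
    using dirichlet_character_eq_0_iff[OF assms(1), of a] dirichlet_character_eq_0_iff[OF assms(2), of a]
    by simp
qed

text \<open>If m did not divide d, then gcd(d, m) would be a proper divisor of m, and primitivity
  gives b = 1 modulo it with \<chi>(b) different from 1. A Chinese remainder lift c of (b mod m, 1
  mod n) is then 1 modulo d, although the product character takes the value \<chi>(b) at c.\<close>

lemma induced_modulus_times_coprime:
  assumes "\<chi> \<in> primitive_characters m" "dirichlet_character n \<psi>" "coprime m n" "m > 0"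
    and ind: "induced_modulus (m * n) (\<lambda>a. \<chi> a * \<psi> a) d"
  shows "m dvd d"
proof (rule ccontr)
  assume "\<not> m dvd d"
  hence "gcd d m \<noteq> m" using gcd_dvd1[of d m] by metis
  then obtain b where b: "coprime b (int m)" "[b = 1] (mod int (gcd d m))" "\<chi> b \<noteq> 1"
    using primitive_character_witness[OF assms(1) _ _ assms(4), of "gcd d m"] by auto
  have char: "dirichlet_character m \<chi>" using assms(1) by (simp add: primitive_characters_def)
  obtain c where c: "[c = b] (mod int m)" "[c = 1] (mod int n)"
    using binary_chinese_remainder_int[of "int m" "int n" b 1] assms(3) by auto
  have "coprime c (int (m * n))"
    using coprime_cong_cong_left[OF c(1)] coprime_cong_cong_left[OF c(2)] b(1) by simp
  moreover have "[c = 1] (mod int d)"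
  proof -
    have "[c = 1] (mod int (gcd d m))"
      using cong_dvd_modulus[OF c(1), of "int (gcd d m)"] b(2) by (auto intro: cong_trans)
    moreover have "[c = 1] (mod int (gcd d n))"
      using cong_dvd_modulus[OF c(2), of "int (gcd d n)"] by simp
    moreover have "coprime (gcd d m) (gcd d n)"
      using assms(3) by (rule coprime_divisors[OF gcd_dvd2 gcd_dvd2])
    ultimately have "[c = 1] (mod int (gcd d m) * int (gcd d n))"
      by (intro coprime_cong_mult) auto
    \<comment> \<open>Since d divides mn, it splits as uv with u dividing m and v dividing n, hence
      u dividing gcd(d, m) and v dividing gcd(d, n).\<close>
    moreover have "int d dvd int (gcd d m) * int (gcd d n)"
    proof -
      have "d dvd m * n" using ind by (simp add: induced_modulus_def)
      then obtain u v where "d = u * v" "u dvd m" "v dvd n" using division_decomp by blast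
      hence "d dvd gcd d m * gcd d n" by (auto intro!: mult_dvd_mono)
      thus ?thesis by (simp flip: of_nat_mult)
    qed
    ultimately show ?thesis by (rule cong_dvd_modulus)
  qed
  ultimately have "\<chi> c * \<psi> c = 1" using ind unfolding induced_modulus_def by blast
  moreover have "\<chi> c = \<chi> b" by (rule dirichlet_character_cong[OF char c(1)])
  moreover have "\<psi> c = 1"
    using dirichlet_character_cong[OF assms(2) c(2)] dirichlet_character_1[OF assms(2)] by simp
  ultimately show False using b(3) by simp
qed

text \<open>Applying the previous lemma to each factor shows that every induced modulus is divisible
  by both m and n, hence by mn.\<close>

lemma primitive_characters_times:
  assumes "\<chi> \<in> primitive_characters m" "\<psi> \<in> primitive_characters n" "coprime m n" "m > 0" "n > 0"
  shows "(\<lambda>a. \<chi> a * \<psi> a) \<in> primitive_characters (m * n)"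
proof -
  have char: "dirichlet_character m \<chi>" "dirichlet_character n \<psi>"
    using assms(1,2) by (simp_all add: primitive_characters_def)
  have "\<not> induced_modulus (m * n) (\<lambda>a. \<chi> a * \<psi> a) d" if "d < m * n" for d
  proof
    assume ind: "induced_modulus (m * n) (\<lambda>a. \<chi> a * \<psi> a) d"
    have "m dvd d"
      by (rule induced_modulus_times_coprime[OF assms(1) char(2) assms(3,4) ind])
    moreover have "n dvd d"
      using ind by (intro induced_modulus_times_coprime[OF assms(2) char(1) _ assms(5)])
        (use assms(3) in \<open>simp_all add: coprime_commute mult.commute\<close>)
    ultimately have "m * n dvd d" using assms(3) by (rule divides_mult)
    moreover have "d > 0"
      using ind assms(4,5) by (auto simp: induced_modulus_def intro!: Nat.gr0I)
    ultimately show False using that by (auto dest: dvd_imp_le)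
  qed
  with dirichlet_character_times[OF char] show ?thesis by (simp add: primitive_characters_def)
qed

subsection \<open>Duality and dyadic decomposition\<close>

text \<open>Write the left side T as a sum of a_n g_n, with g the adjoint applied to the conjugates
  of the B_s. Cauchy-Schwarz leaves the sum of |g_n|^2, a quadratic form in B whose matrix of
  correlations has row sums at most D. This gives T^2 <= D Z T.\<close>

lemma halasz_montgomery:
  fixes a :: "'n \<Rightarrow> complex" and c :: "'s \<Rightarrow> 'n \<Rightarrow> complex"
  assumes "D \<ge> 0"
    and D: "\<And>s. s \<in> S \<Longrightarrow> (\<Sum>t\<in>S. norm (\<Sum>n\<in>A. c s n * cnj (c t n))) \<le> D"
  shows "(\<Sum>s\<in>S. norm (\<Sum>n\<in>A. a n * c s n) ^ 2) \<le> D * (\<Sum>n\<in>A. norm (a n) ^ 2)"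
proof -
  define B where "B = (\<lambda>s. \<Sum>n\<in>A. a n * c s n)"
  define g where "g = (\<lambda>n. \<Sum>s\<in>S. cnj (B s) * c s n)"
  define C where "C = (\<lambda>s t. norm (\<Sum>n\<in>A. c s n * cnj (c t n)))"
  define T where "T = (\<Sum>s\<in>S. norm (B s) ^ 2)"
  define Z where "Z = (\<Sum>n\<in>A. norm (a n) ^ 2)"
  have Z0: "Z \<ge> 0" and T0: "T \<ge> 0" by (simp_all add: Z_def T_def sum_nonneg)
  have C_commute: "C s t = C t s" for s t
  proof -
    have "(\<Sum>n\<in>A. c t n * cnj (c s n)) = cnj (\<Sum>n\<in>A. c s n * cnj (c t n))"
      by (simp add: mult.commute)
    thus ?thesis unfolding C_def by (simp only: complex_mod_cnj)
  qed
  have B_mult: "B s * z = (\<Sum>n\<in>A. a n * (z * c s n))" for s z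
    by (simp add: B_def sum_distrib_left sum_distrib_right mult_ac)
  have "complex_of_real T = (\<Sum>s\<in>S. B s * cnj (B s))"
    unfolding T_def by (simp only: of_real_sum complex_norm_square)
  also have "\<dots> = (\<Sum>s\<in>S. \<Sum>n\<in>A. a n * (cnj (B s) * c s n))"
    by (simp only: B_mult)
  also have "\<dots> = (\<Sum>n\<in>A. a n * g n)"
    by (subst sum.swap) (simp add: g_def sum_distrib_left)
  finally have "T = norm (\<Sum>n\<in>A. a n * g n)"
    using T0 by (metis norm_of_real abs_of_nonneg)
  also have "\<dots> \<le> (\<Sum>n\<in>A. norm (a n) * norm (g n))"
    by (rule sum_norm_le) (simp add: norm_mult)
  finally have "T\<^sup>2 \<le> (\<Sum>n\<in>A. norm (a n) * norm (g n))\<^sup>2"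
    using T0 by (intro power_mono) auto
  also have "\<dots> \<le> Z * (\<Sum>n\<in>A. norm (g n) ^ 2)"
    unfolding Z_def by (rule Cauchy_Schwarz_ineq_sum)
  finally have T_le: "T\<^sup>2 \<le> Z * (\<Sum>n\<in>A. norm (g n) ^ 2)" .
  have "(\<Sum>n\<in>A. norm (g n) ^ 2) \<le> D * T"
  proof -
    have "complex_of_real (\<Sum>n\<in>A. norm (g n) ^ 2) = (\<Sum>n\<in>A. g n * cnj (g n))"
      by (simp only: of_real_sum complex_norm_square)
    also have "\<dots> = (\<Sum>n\<in>A. \<Sum>s\<in>S. \<Sum>t\<in>S. cnj (B s) * B t * (c s n * cnj (c t n)))"
      unfolding g_def cnj_sum sum_product by (simp add: mult_ac)
    also have "\<dots> = (\<Sum>s\<in>S. \<Sum>n\<in>A. \<Sum>t\<in>S. cnj (B s) * B t * (c s n * cnj (c t n)))"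
      by (rule sum.swap)
    also have "\<dots> = (\<Sum>s\<in>S. \<Sum>t\<in>S. \<Sum>n\<in>A. cnj (B s) * B t * (c s n * cnj (c t n)))"
      by (intro sum.cong refl sum.swap)
    also have "\<dots> = (\<Sum>s\<in>S. \<Sum>t\<in>S. cnj (B s) * B t * (\<Sum>n\<in>A. c s n * cnj (c t n)))"
      by (simp add: sum_distrib_left)
    finally have eq: "complex_of_real (\<Sum>n\<in>A. norm (g n) ^ 2)
        = (\<Sum>s\<in>S. \<Sum>t\<in>S. cnj (B s) * B t * (\<Sum>n\<in>A. c s n * cnj (c t n)))" .
    have "(\<Sum>n\<in>A. norm (g n) ^ 2) = norm (complex_of_real (\<Sum>n\<in>A. norm (g n) ^ 2))"
      by (subst norm_of_real) (simp add: sum_nonneg)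
    also have "\<dots> = norm (\<Sum>s\<in>S. \<Sum>t\<in>S. cnj (B s) * B t * (\<Sum>n\<in>A. c s n * cnj (c t n)))"
      by (simp only: eq)
    also have "\<dots> \<le> (\<Sum>s\<in>S. \<Sum>t\<in>S. norm (B s) * norm (B t) * C s t)"
      by (intro sum_norm_le) (simp add: norm_mult C_def)
    \<comment> \<open>Schur's test: the arithmetic-geometric mean inequality separates s from t, and
      the symmetry of C makes the two halves equal, so only row sums remain.\<close>
    also have "\<dots> \<le> (\<Sum>s\<in>S. \<Sum>t\<in>S. (norm (B s) ^ 2 / 2 + norm (B t) ^ 2 / 2) * C s t)"
    proof (intro sum_mono mult_right_mono)
      fix s t
      show "norm (B s) * norm (B t) \<le> norm (B s) ^ 2 / 2 + norm (B t) ^ 2 / 2"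
        using sum_squares_bound[of "norm (B s)" "norm (B t)"] by simp
    qed (simp add: C_def)
    also have "\<dots> = (\<Sum>s\<in>S. \<Sum>t\<in>S. norm (B s) ^ 2 / 2 * C s t) + (\<Sum>s\<in>S. \<Sum>t\<in>S. norm (B t) ^ 2 / 2 * C s t)"
      by (simp add: distrib_right sum.distrib)
    also have "(\<Sum>s\<in>S. \<Sum>t\<in>S. norm (B t) ^ 2 / 2 * C s t) = (\<Sum>s\<in>S. \<Sum>t\<in>S. norm (B s) ^ 2 / 2 * C s t)"
    proof (subst sum.swap, intro sum.cong refl)
      fix s t show "norm (B s) ^ 2 / 2 * C t s = norm (B s) ^ 2 / 2 * C s t"
        by (simp only: C_commute[of t s])
    qed
    also have "(\<Sum>s\<in>S. \<Sum>t\<in>S. norm (B s) ^ 2 / 2 * C s t) + (\<Sum>s\<in>S. \<Sum>t\<in>S. norm (B s) ^ 2 / 2 * C s t)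
        = (\<Sum>s\<in>S. norm (B s) ^ 2 * (\<Sum>t\<in>S. C s t))"
      by (simp add: sum_distrib_left sum_distrib_right mult_ac flip: sum.distrib)
    also have "\<dots> \<le> (\<Sum>s\<in>S. norm (B s) ^ 2 * D)"
      using D by (intro sum_mono mult_left_mono) (auto simp: C_def)
    finally show ?thesis by (simp add: T_def sum_distrib_left mult.commute)
  qed
  hence "Z * (\<Sum>n\<in>A. norm (g n) ^ 2) \<le> Z * (D * T)"
    using Z0 by (rule mult_left_mono)
  with T_le have "T * T \<le> (D * Z) * T"
    by (simp add: power2_eq_square mult_ac)
  have "T \<le> D * Z"
  proof (cases "T > 0")
    case True
    with \<open>T * T \<le> D * Z * T\<close> show ?thesis by (simp only: mult_le_cancel_right_pos)
  next
    case False
    with mult_nonneg_nonneg[OF assms(1) Z0] show ?thesis by linarith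
  qed
  thus ?thesis by (simp only: T_def Z_def B_def)
qed

text \<open>Truncating m to multiples of 2^j for successive j telescopes the sum; each increment
  \<open>G j - G (Suc j)\<close> is zero or a single dyadic block, according to a binary digit of m.
  Summing over all blocks makes the right-hand side independent of m apart from its bound.\<close>

lemma dyadic_block_decomposition:
  fixes f :: "nat \<Rightarrow> 'a::real_normed_vector"
  assumes "m < 2 ^ Suc K"
  shows "norm (\<Sum>n<m. f n) ^ r
    \<le> real (Suc K) ^ r * (\<Sum>j\<le>K. \<Sum>i<2 ^ (Suc K - j). norm (\<Sum>n\<in>{i * 2 ^ j..<(i + 1) * 2 ^ j}. f n) ^ r)"
proof -
  define blk where "blk = (\<lambda>i j. \<Sum>n\<in>{i * 2 ^ j..<(i + 1) * 2 ^ j :: nat}. f n)"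
  define F where "F = (\<lambda>m. \<Sum>n<m. f n)"
  define G where "G = (\<lambda>j. F (m div 2 ^ j * 2 ^ j))"
  define \<Sigma> where "\<Sigma> = (\<Sum>j\<le>K. \<Sum>i<2 ^ (Suc K - j). norm (blk i j) ^ r)"
  have F_add: "F (u + v) = F u + (\<Sum>n\<in>{u..<u + v}. f n)" for u v
    unfolding F_def by (simp add: lessThan_atLeast0 sum.atLeastLessThan_concat)
  have inner: "norm (blk i j) ^ r \<le> \<Sigma>" if "j \<le> K" "i < 2 ^ (Suc K - j)" for i j
  proof -
    have "norm (blk i j) ^ r \<le> (\<Sum>i<2 ^ (Suc K - j). norm (blk i j) ^ r)"
      using that by (intro member_le_sum) auto
    also have "\<dots> \<le> \<Sigma>"
      unfolding \<Sigma>_def using that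
      by (intro member_le_sum[of j "{..K}" "\<lambda>j. \<Sum>i<2 ^ (Suc K - j). norm (blk i j) ^ r"])
         (auto intro: sum_nonneg)
    finally show ?thesis .
  qed
  have step: "norm (G j - G (Suc j)) = 0 \<or> (\<exists>i<2 ^ (Suc K - j). G j - G (Suc j) = blk i j)"
    if "j \<le> K" for j
  proof -
    define q where "q = m div 2 ^ Suc j"
    have qdef: "q = m div 2 ^ j div 2" unfolding q_def by (simp only: power_Suc2 div_mult2_eq)
    have Gs: "G (Suc j) = F ((2 * q) * 2 ^ j)" by (simp add: G_def q_def mult_ac)
    consider "m div 2 ^ j = 2 * q" | "m div 2 ^ j = 2 * q + 1" unfolding qdef by linarith
    thus ?thesis
    proof cases
      case 1
      thus ?thesis using Gs by (simp add: G_def)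
    next
      case 2
      have "m < 2 ^ (Suc K - j) * 2 ^ j"
        using assms that by (simp flip: power_add)
      hence "m div 2 ^ j < 2 ^ (Suc K - j)" by (simp add: div_less_iff_less_mult)
      moreover have "G j = G (Suc j) + blk (2 * q) j"
        using F_add[of "2 * q * 2 ^ j" "2 ^ j"] 2 Gs by (simp add: G_def blk_def add.commute)
      ultimately show ?thesis using 2 by (intro disjI2 exI[of _ "2 * q"]) auto
    qed
  qed
  have "(\<Sum>j<Suc K. G j - G (Suc j)) = G 0 - G (Suc K)"
    by (rule sum_lessThan_telescope')
  hence tel: "F m = (\<Sum>j<Suc K. G j - G (Suc j))"
    using assms by (simp add: G_def F_def)
  \<comment> \<open>The sum is at most K + 1 times its largest increment, and the r-th power of that
    increment is at most the sum over all blocks.\<close>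
  define B where "B = Max ((\<lambda>j. norm (G j - G (Suc j))) ` {..K})"
  have "B \<in> (\<lambda>j. norm (G j - G (Suc j))) ` {..K}" unfolding B_def by (intro Max_in) auto
  then obtain j0 where j0: "j0 \<le> K" "B = norm (G j0 - G (Suc j0))" by auto
  have "norm (F m) \<le> (\<Sum>j<Suc K. B)"
    unfolding tel by (intro sum_norm_le) (auto simp: B_def intro!: Max_ge)
  hence FB: "norm (F m) \<le> real (Suc K) * B" by simp
  \<comment> \<open>The exponent 0 is separate because a vanishing increment then has power 0^0 = 1;
    any one block already contributes 1 on the right.\<close>
  show ?thesis
  proof (cases "r = 0")
    case True
    hence "1 \<le> \<Sigma>" using inner[of 0 0] by simp
    thus ?thesis using True by (simp add: \<Sigma>_def blk_def)
  next
    case False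
    have "\<Sigma> \<ge> 0" unfolding \<Sigma>_def by (intro sum_nonneg) auto
    hence "B ^ r \<le> \<Sigma>"
      using step[OF j0(1)] inner[OF j0(1)] False unfolding j0(2) by (auto simp: power_0_left)
    have "norm (F m) ^ r \<le> (real (Suc K) * B) ^ r" using FB by (intro power_mono) auto
    also have "\<dots> \<le> real (Suc K) ^ r * \<Sigma>"
      using \<open>B ^ r \<le> \<Sigma>\<close> by (simp add: power_mult_distrib mult_left_mono del: of_nat_Suc)
    finally show ?thesis by (simp add: F_def \<Sigma>_def blk_def)
  qed
qed

subsection \<open>Moments of the divisor function\<close>

definition divisor_count :: "nat \<Rightarrow> nat" where
  "divisor_count n = card {d. d dvd n}"

text \<open>Every divisor of mn is a product of a divisor of m and one of n, though perhaps in
  several ways, so multiplication of divisor pairs is onto.\<close>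

lemma divisor_count_mult_le:
  assumes "m > 0" "n > 0"
  shows "divisor_count (m * n) \<le> divisor_count m * divisor_count n"
proof -
  have "{d. d dvd m * n} \<subseteq> (\<lambda>(u, v). u * v) ` ({d. d dvd m} \<times> {d. d dvd n})"
  proof
    fix d assume "d \<in> {d. d dvd m * n}"
    then obtain u v where "d = u * v" "u dvd m" "v dvd n" using division_decomp by blast
    thus "d \<in> (\<lambda>(u, v). u * v) ` ({d. d dvd m} \<times> {d. d dvd n})" by auto
  qed
  hence "card {d. d dvd m * n} \<le> card ({d. d dvd m} \<times> {d. d dvd n})"
    using assms by (intro surj_card_le) auto
  thus ?thesis by (simp add: divisor_count_def card_cartesian_product)
qed

text \<open>Induction on k: one factor of the divisor function becomes a sum over n = de, and
  submultiplicativity bounds the rest by a product of a term in d and a term in e. Each step thus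
  squares the previous bound, whence the exponent 2^k.\<close>

lemma sum_divisor_count_power_over_n_le:
  assumes "X > 0"
  shows "(\<Sum>n=1..X. real (divisor_count n) ^ k / real n) \<le> (1 + ln (real X)) ^ (2 ^ k)"
proof (induction k)
  case 0
  thus ?case using sum_inverse_le_ln[OF assms] by simp
next
  case (Suc k)
  define g where "g = (\<lambda>n. real (divisor_count n) ^ k / real n)"
  define h where "h = (\<lambda>(n::nat, d::nat). (d, n div d))"
  let ?A = "Sigma {1..X} (\<lambda>n. {d. d dvd n})"
  have inj: "inj_on h ?A"
    by (rule inj_on_inverseI[where g = "\<lambda>(u, v). (u * v, u)"]) (auto simp: h_def)
  have "(\<Sum>n=1..X. real (divisor_count n) ^ Suc k / real n) = (\<Sum>n=1..X. \<Sum>d\<in>{d. d dvd n}. g n)"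
    by (simp add: divisor_count_def g_def)
  also have "\<dots> = (\<Sum>(n, d)\<in>?A. g n)"
    by (rule sum.Sigma) auto
  also have "\<dots> \<le> (\<Sum>x\<in>?A. case h x of (u, v) \<Rightarrow> g u * g v)"
  proof (rule sum_mono)
    fix x assume x: "x \<in> ?A"
    obtain n d where nd: "x = (n, d)" by (cases x)
    with x obtain e where e: "n = d * e" and "n > 0" by (auto simp: dvd_def)
    hence pos: "d > 0" "e > 0" by auto
    have "g n \<le> (real (divisor_count d) * real (divisor_count e)) ^ k / real n"
      unfolding g_def e using divisor_count_mult_le[OF pos]
      by (intro divide_right_mono power_mono) (simp_all flip: of_nat_mult)
    also have "\<dots> = g d * g e" by (simp add: g_def e power_mult_distrib)
    finally show "(case x of (n, d) \<Rightarrow> g n) \<le> (case h x of (u, v) \<Rightarrow> g u * g v)"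
      using pos by (simp add: nd h_def e)
  qed
  also have "\<dots> = (\<Sum>(u, v)\<in>h ` ?A. g u * g v)"
    by (subst sum.reindex[OF inj]) (simp add: o_def)
  also have "\<dots> \<le> (\<Sum>(u, v)\<in>{1..X} \<times> {1..X}. g u * g v)"
  proof (rule sum_mono2)
    show "h ` ?A \<subseteq> {1..X} \<times> {1..X}"
    proof (rule image_subsetI)
      fix x assume x: "x \<in> ?A"
      obtain n d where nd: "x = (n, d)" by (cases x)
      with x have "d dvd n" "1 \<le> n" "n \<le> X" by auto
      moreover from this obtain e where e: "n = d * e" by (auto simp: dvd_def)
      ultimately have "d > 0" "e > 0" by auto
      moreover from this have "d \<le> n" "e \<le> n" unfolding e by simp_all
      ultimately have "d \<in> {1..X}" "e \<in> {1..X}" using \<open>n \<le> X\<close> by auto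
      thus "h x \<in> {1..X} \<times> {1..X}" by (simp add: nd h_def e)
    qed
  qed (auto simp: g_def)
  also have "\<dots> = (\<Sum>n=1..X. g n) * (\<Sum>n=1..X. g n)"
    by (simp add: sum_product sum.cartesian_product)
  also have "\<dots> \<le> (1 + ln (real X)) ^ (2 ^ k) * (1 + ln (real X)) ^ (2 ^ k)"
  proof (rule mult_mono)
    show "0 \<le> (\<Sum>n=1..X. g n)" by (simp add: g_def sum_nonneg)
    show "0 \<le> (1 + ln (real X)) ^ (2 ^ k)" using assms by simp
  qed (use Suc.IH in \<open>simp_all only: g_def\<close>)
  also have "\<dots> = (1 + ln (real X)) ^ (2 ^ Suc k)"
    by (simp add: mult_2 flip: power_add)
  finally show ?case .
qed

text \<open>Inserting the weight X/n >= 1 reduces this to the logarithmically weighted sum.\<close>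

lemma sum_divisor_count_power_le:
  assumes "X > 0"
  shows "(\<Sum>n=1..X. real (divisor_count n) ^ k) \<le> real X * (1 + ln (real X)) ^ (2 ^ k)"
proof -
  have "(\<Sum>n=1..X. real (divisor_count n) ^ k) \<le> (\<Sum>n=1..X. real X * (real (divisor_count n) ^ k / real n))"
  proof (rule sum_mono)
    fix n assume n: "n \<in> {1..X}"
    hence "real n * real (divisor_count n) ^ k \<le> real X * real (divisor_count n) ^ k"
      by (intro mult_right_mono) auto
    thus "real (divisor_count n) ^ k \<le> real X * (real (divisor_count n) ^ k / real n)"
      using n by (simp add: field_simps)
  qed
  also have "\<dots> = real X * (\<Sum>n=1..X. real (divisor_count n) ^ k / real n)"
    by (simp only: sum_distrib_left)
  also have "\<dots> \<le> real X * (1 + ln (real X)) ^ (2 ^ k)"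
    by (intro mult_left_mono sum_divisor_count_power_over_n_le assms) simp
  finally show ?thesis .
qed

section \<open>Factorization counts as coefficients of powers of character sums\<close>

text \<open>Ordered factorizations of n into k factors from I. Extensional functions represent
  k-tuples, so the cardinality is the coefficient of \<chi>(n) in the k-th power of the sum of
  \<chi> over I.\<close>

definition factorizations_in :: "nat set \<Rightarrow> nat \<Rightarrow> nat \<Rightarrow> (nat \<Rightarrow> nat) set" where
  "factorizations_in I k n = {f \<in> PiE {..<k} (\<lambda>_. I). (\<Prod>i<k. f i) = n}"

lemma finite_factorizations_in: "finite I \<Longrightarrow> finite (factorizations_in I k n)"
  unfolding factorizations_in_def
  by (rule finite_subset[of _ "PiE {..<k} (\<lambda>_. I)"]) (auto intro: finite_PiE)

lemma factorizations_in_subset: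
  assumes "n > 0"
  shows "factorizations_in I k n \<subseteq> PiE {..<k} (\<lambda>_. {d. d dvd n})"
proof
  fix f assume "f \<in> factorizations_in I k n"
  hence f: "f \<in> PiE {..<k} (\<lambda>_. I)" "(\<Prod>i<k. f i) = n"
    by (simp_all add: factorizations_in_def)
  have "f i dvd n" if "i < k" for i
    unfolding f(2)[symmetric] using that by (intro dvd_prodI) auto
  thus "f \<in> PiE {..<k} (\<lambda>_. {d. d dvd n})" using f(1) by (simp add: PiE_iff)
qed

text \<open>For disjoint I(i), the first factor of a tuple determines i, so the sets of
  factorizations are disjoint; all of them lie among the k-tuples of divisors of n.\<close>

lemma sum_card_factorizations_in_le:
  assumes "finite J" "disjoint_family_on I J" "\<And>i. i \<in> J \<Longrightarrow> finite (I i)" "k > 0" "n > 0"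
  shows "(\<Sum>i\<in>J. card (factorizations_in (I i) k n)) \<le> divisor_count n ^ k"
proof -
  have disj: "factorizations_in (I i) k n \<inter> factorizations_in (I j) k n = {}"
    if "i \<in> J" "j \<in> J" "i \<noteq> j" for i j
  proof -
    have "f 0 \<in> I i \<inter> I j" if "f \<in> factorizations_in (I i) k n \<inter> factorizations_in (I j) k n" for f
      using that assms(4) by (auto simp: factorizations_in_def PiE_iff)
    thus ?thesis using that assms(2) unfolding disjoint_family_on_def by blast
  qed
  have "(\<Sum>i\<in>J. card (factorizations_in (I i) k n)) = card (\<Union>i\<in>J. factorizations_in (I i) k n)"
    using assms(1,3) disj by (intro card_UN_disjoint[symmetric]) (auto simp: finite_factorizations_in)
  also have "\<dots> \<le> card (PiE {..<k} (\<lambda>_. {d. d dvd n}))"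
  proof (rule card_mono)
    show "finite (PiE {..<k} (\<lambda>_. {d. d dvd n}))"
      using assms(5) by (simp add: finite_PiE)
  qed (use factorizations_in_subset[OF assms(5)] in blast)
  also have "\<dots> = divisor_count n ^ k"
    by (simp add: card_PiE divisor_count_def)
  finally show ?thesis .
qed

lemma dirichlet_character_0:
  assumes "dirichlet_character q \<chi>" "q > 1"
  shows "\<chi> 0 = 0"
  using dirichlet_character_eq_0_iff[OF assms(1), of 0] assms(2) by simp

lemma dirichlet_character_sum_power:
  assumes char: "dirichlet_character q \<chi>" "q > 1" and I: "I \<subseteq> {..<m}"
  shows "(\<Sum>n\<in>I. \<chi> (int n)) ^ k
    = (\<Sum>n=1..m ^ k. of_nat (card (factorizations_in I k n)) * \<chi> (int n))"
proof -
  let ?F = "PiE {..<k} (\<lambda>_. I)"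
  have finI: "finite I" using I finite_subset by blast
  hence fin: "finite ?F" by (intro finite_PiE) auto
  have im: "(\<lambda>f. \<Prod>i<k. f i) ` ?F \<subseteq> {0..m ^ k}"
  proof (rule image_subsetI)
    fix f assume f: "f \<in> ?F"
    have "(\<Prod>i<k. f i) \<le> (\<Prod>i<k. m)"
      using f I by (intro prod_mono) (auto simp: PiE_iff intro!: less_imp_le)
    thus "(\<Prod>i<k. f i) \<in> {0..m ^ k}" by simp
  qed
  have "(\<Sum>n\<in>I. \<chi> (int n)) ^ k = (\<Prod>i<k. \<Sum>n\<in>I. \<chi> (int n))" by simp
  also have "\<dots> = (\<Sum>f\<in>?F. \<Prod>i<k. \<chi> (int (f i)))"
    by (rule prod_sum_PiE) (use finI in auto)
  also have "\<dots> = (\<Sum>f\<in>?F. \<chi> (int (\<Prod>i<k. f i)))"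
    by (simp add: dirichlet_character_prod[OF char(1)])
  also have "\<dots> = (\<Sum>n\<in>{0..m ^ k}. \<Sum>f\<in>{f \<in> ?F. (\<Prod>i<k. f i) = n}. \<chi> (int (\<Prod>i<k. f i)))"
    by (rule sum.group[OF fin _ im, symmetric]) simp
  also have "\<dots> = (\<Sum>n\<in>{0..m ^ k}. of_nat (card (factorizations_in I k n)) * \<chi> (int n))"
    by (simp add: factorizations_in_def)
  also have "\<dots> = (\<Sum>n=1..m ^ k. of_nat (card (factorizations_in I k n)) * \<chi> (int n))"
    \<comment> \<open>The index 0 arises when I contains 0; it disappears because \<chi>(0) =
      0.\<close>
    using dirichlet_character_0[OF char] by (intro sum.mono_neutral_right) (auto simp: not_less_eq_eq)
  finally show ?thesis .
qed

lemma sum_power2_le_power2_sum: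
  fixes f :: "'a \<Rightarrow> real"
  assumes "finite A" "\<And>x. x \<in> A \<Longrightarrow> f x \<ge> 0"
  shows "(\<Sum>x\<in>A. f x ^ 2) \<le> (\<Sum>x\<in>A. f x) ^ 2"
proof -
  have "(\<Sum>x\<in>A. f x ^ 2) \<le> (\<Sum>x\<in>A. f x * (\<Sum>y\<in>A. f y))"
    unfolding power2_eq_square using assms
    by (intro sum_mono mult_left_mono member_le_sum) auto
  thus ?thesis by (simp add: power2_eq_square sum_distrib_right)
qed

subsection \<open>Mean values over primes\<close>

text \<open>Polya-Vinogradov for the primitive product character modulo p^2 r^2 <= B^4: the square
  root gives B^2 and the logarithm 4 ln B.\<close>

lemma norm_sum_primitive_characters_le:
  assumes p: "prime p" "p \<le> B" and r: "prime r" "r \<le> B" and "p \<noteq> r"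
    and \<chi>: "\<chi> \<in> primitive_characters (p ^ 2)" and \<psi>: "\<psi> \<in> primitive_characters (r ^ 2)"
  shows "norm (\<Sum>n=1..M. \<chi> (int n) * cnj (\<psi> (int n))) \<le> real B ^ 2 * (1 + 4 * ln (real B))"
proof -
  define q where "q = p ^ 2 * r ^ 2"
  define \<phi> where "\<phi> = (\<lambda>a. \<chi> a * cnj (\<psi> a))"
  have pos: "p > 1" "r > 1" using p r prime_gt_1_nat by blast+
  have co: "coprime (p ^ 2) (r ^ 2)"
    using primes_coprime[OF p(1) r(1) assms(5)] by simp
  have \<phi>: "\<phi> \<in> primitive_characters q"
    unfolding \<phi>_def q_def
    by (rule primitive_characters_times[OF \<chi> primitive_characters_cnj[OF \<psi>] co]) (use pos in auto)
  have q1: "q > 1"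
    using pos unfolding q_def by (intro less_1_mult one_less_power) auto
  have "\<phi> 0 = 0"
    by (rule dirichlet_character_0[OF _ q1]) (use \<phi> in \<open>simp add: primitive_characters_def\<close>)
  hence "(\<Sum>n=1..M. \<phi> (int n)) = (\<Sum>n<Suc M. \<phi> (int n))"
    by (intro sum.mono_neutral_left) (auto simp: not_less_eq_eq less_Suc_eq_le)
  hence "norm (\<Sum>n=1..M. \<phi> (int n)) \<le> sqrt (real q) * (1 + ln (real q))"
    using polya_vinogradov[OF \<phi> q1, of "Suc M"] by simp
  also have "\<dots> \<le> real B ^ 2 * (1 + 4 * ln (real B))"
  proof (rule mult_mono)
    have "real q \<le> (real B ^ 2) ^ 2"
    proof -
      have "q \<le> B ^ 2 * B ^ 2"
        unfolding q_def using p r by (intro mult_mono power_mono) auto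
      also have "\<dots> = (B ^ 2) ^ 2" by (simp add: power2_eq_square)
      finally have "real q \<le> real ((B ^ 2) ^ 2)" by (rule of_nat_mono)
      thus ?thesis by simp
    qed
    thus "sqrt (real q) \<le> real B ^ 2" by (intro real_le_lsqrt) auto
    have "B > 1" using p pos by linarith
    have "ln (real q) \<le> ln ((real B ^ 2) ^ 2)"
      using \<open>real q \<le> (real B ^ 2) ^ 2\<close> q1 by (intro ln_mono) auto
    also have "\<dots> = 4 * ln (real B)"
      using \<open>B > 1\<close> by (simp add: ln_realpow)
    finally show "1 + ln (real q) \<le> 1 + 4 * ln (real B)" by simp
  qed (use q1 in auto)
  finally show ?thesis by (simp add: \<phi>_def)
qed

text \<open>Duality with row sums split into the diagonal term, at most M, and at most P
  off-diagonal terms, each bounded by the preceding lemma with B = 2P.\<close>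

lemma large_sieve_one_character_per_prime:
  assumes "\<And>p. prime p \<Longrightarrow> P < p \<Longrightarrow> p \<le> 2 * P \<Longrightarrow> \<chi> p \<in> primitive_characters (p ^ 2)" "P > 0"
  shows "(\<Sum>p | prime p \<and> P < p \<and> p \<le> 2 * P. norm (\<Sum>n=1..M. a n * \<chi> p (int n)) ^ 2)
    \<le> (real M + 4 * real P ^ 3 * (1 + 4 * ln (2 * real P))) * (\<Sum>n=1..M. norm (a n) ^ 2)"
proof (rule halasz_montgomery)
  let ?S = "{p. prime p \<and> P < p \<and> p \<le> 2 * P}"
  let ?E = "4 * real P ^ 2 * (1 + 4 * ln (2 * real P))"
  have S: "?S \<subseteq> {P<..2 * P}" by auto
  hence fin: "finite ?S" by (rule finite_subset) simp
  have card: "card ?S \<le> P"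
    using card_mono[OF _ S] by simp
  have ln0: "ln (2 * real P) \<ge> 0" using assms(2) by simp
  hence E0: "?E \<ge> 0" by simp
  show "0 \<le> real M + 4 * real P ^ 3 * (1 + 4 * ln (2 * real P))" using ln0 by simp
  fix p assume p: "p \<in> ?S"
  have "norm (\<chi> p a) \<le> 1" for a
    by (rule norm_dirichlet_character_le_1[of "p ^ 2"])
       (use p assms(1) in \<open>auto simp: primitive_characters_def\<close>)
  hence "norm (\<chi> p (int n) * cnj (\<chi> p (int n))) \<le> 1" for n
    by (simp add: norm_mult mult_le_one)
  hence "norm (\<Sum>n=1..M. \<chi> p (int n) * cnj (\<chi> p (int n))) \<le> (\<Sum>n=1..M. 1)"
    by (intro sum_norm_le)
  hence diag: "norm (\<Sum>n=1..M. \<chi> p (int n) * cnj (\<chi> p (int n))) \<le> real M" by simp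
  have off: "norm (\<Sum>n=1..M. \<chi> p (int n) * cnj (\<chi> r (int n))) \<le> ?E" if "r \<in> ?S - {p}" for r
    using norm_sum_primitive_characters_le[of p "2 * P" r "\<chi> p" "\<chi> r" M] p that assms(1)
    by (simp add: power_mult_distrib)
  have "(\<Sum>r\<in>?S. norm (\<Sum>n=1..M. \<chi> p (int n) * cnj (\<chi> r (int n))))
      = norm (\<Sum>n=1..M. \<chi> p (int n) * cnj (\<chi> p (int n)))
        + (\<Sum>r\<in>?S - {p}. norm (\<Sum>n=1..M. \<chi> p (int n) * cnj (\<chi> r (int n))))"
    by (rule sum.remove[OF fin p])
  also have "\<dots> \<le> real M + (\<Sum>r\<in>?S - {p}. ?E)"
    by (intro add_mono diag sum_mono off)
  also have "(\<Sum>r\<in>?S - {p}. ?E) \<le> real P * ?E"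
  proof -
    have "real (card (?S - {p})) \<le> real P"
      using card card_Diff1_le[of ?S p] by linarith
    hence "real (card (?S - {p})) * ?E \<le> real P * ?E" using E0 by (rule mult_right_mono)
    thus ?thesis by (simp only: sum_constant)
  qed
  finally show "(\<Sum>r\<in>?S. norm (\<Sum>n=1..M. \<chi> p (int n) * cnj (\<chi> r (int n))))
      \<le> real M + 4 * real P ^ 3 * (1 + 4 * ln (2 * real P))"
    by (simp add: power2_eq_square power3_eq_cube mult_ac)
qed

text \<open>Summing over all dyadic blocks of a given level costs nothing, because the blocks are disjoint and
  their coefficients together are still bounded by a power of the divisor function.\<close>

lemma moment_one_character_per_prime:
  assumes \<chi>: "\<And>p. prime p \<Longrightarrow> P < p \<Longrightarrow> p \<le> 2 * P \<Longrightarrow> \<chi> p \<in> primitive_characters (p ^ 2)"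
    and "P > 0" "k > 0"
    and L: "\<And>p. prime p \<Longrightarrow> P < p \<Longrightarrow> p \<le> 2 * P \<Longrightarrow> L p < 2 ^ Suc K"
  defines "M \<equiv> (2 ^ Suc K) ^ k"
  shows "(\<Sum>p | prime p \<and> P < p \<and> p \<le> 2 * P. norm (\<Sum>n<L p. \<chi> p (int n)) ^ (2 * k))
    \<le> real (Suc K) ^ (2 * k + 1) * (real M + 4 * real P ^ 3 * (1 + 4 * ln (2 * real P)))
       * (real M * (1 + ln (real M)) ^ (2 ^ (2 * k)))"
proof -
  let ?S = "{p. prime p \<and> P < p \<and> p \<le> 2 * P}"
  define I :: "nat \<Rightarrow> nat \<Rightarrow> nat set" where "I = (\<lambda>j i. {i * 2 ^ j..<(i + 1) * 2 ^ j})"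
  define a where "a = (\<lambda>j i n. card (factorizations_in (I j i) k n))"
  define D where "D = real M + 4 * real P ^ 3 * (1 + 4 * ln (2 * real P))"
  define W where "W = real M * (1 + ln (real M)) ^ (2 ^ (2 * k))"
  have D0: "D \<ge> 0" using assms(2) by (simp add: D_def)
  have M0: "M > 0" by (simp add: M_def)
  have I_sub: "I j i \<subseteq> {..<2 ^ Suc K}" if "j \<le> K" "i < 2 ^ (Suc K - j)" for i j
  proof -
    have "(i + 1) * 2 ^ j \<le> 2 ^ (Suc K - j) * 2 ^ j" using that by (intro mult_right_mono) auto
    also have "\<dots> = (2::nat) ^ Suc K" using that by (simp flip: power_add)
    finally show ?thesis by (auto simp: I_def)
  qed
  have disj: "disjoint_family_on (I j) A" for j A
  proof -
    have "i = n div 2 ^ j" if "n \<in> I j i" for n i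
      using that by (intro div_nat_eqI[symmetric]) (auto simp: I_def mult.commute)
    thus ?thesis unfolding disjoint_family_on_def by blast
  qed
  have level: "(\<Sum>i<2 ^ (Suc K - j). \<Sum>p\<in>?S. norm (\<Sum>n\<in>I j i. \<chi> p (int n)) ^ (2 * k)) \<le> D * W"
    if "j \<le> K" for j
  proof -
    let ?B = "{..<2 ^ (Suc K - j) :: nat}"
    have block: "(\<Sum>p\<in>?S. norm (\<Sum>n\<in>I j i. \<chi> p (int n)) ^ (2 * k)) \<le> D * (\<Sum>n=1..M. real (a j i n) ^ 2)"
      if i: "i \<in> ?B" for i
    proof -
      \<comment> \<open>All blocks lie below 2^(K+1), so products of k elements are at most
        \<open>M\<close>, and the coefficients \<open>a j i n\<close> do not depend on
        \<open>p\<close>.\<close>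
      have "norm (\<Sum>n\<in>I j i. \<chi> p (int n)) ^ (2 * k) = norm (\<Sum>n=1..M. of_nat (a j i n) * \<chi> p (int n)) ^ 2"
        if p: "p \<in> ?S" for p
      proof -
        have "dirichlet_character (p ^ 2) (\<chi> p)" "p ^ 2 > 1"
          using \<chi>[of p] p prime_gt_1_nat[of p]
          by (auto simp: primitive_characters_def intro!: one_less_power simp del: One_nat_def)
        from dirichlet_character_sum_power[OF this I_sub[OF \<open>j \<le> K\<close>], of i k] i
        have "(\<Sum>n\<in>I j i. \<chi> p (int n)) ^ k = (\<Sum>n=1..M. of_nat (a j i n) * \<chi> p (int n))"
          by (simp add: a_def M_def)
        thus ?thesis by (metis norm_power power_mult mult.commute)
      qed
      hence "(\<Sum>p\<in>?S. norm (\<Sum>n\<in>I j i. \<chi> p (int n)) ^ (2 * k))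
          = (\<Sum>p\<in>?S. norm (\<Sum>n=1..M. of_nat (a j i n) * \<chi> p (int n)) ^ 2)"
        by (intro sum.cong refl)
      also have "\<dots> \<le> D * (\<Sum>n=1..M. norm (of_nat (a j i n) :: complex) ^ 2)"
        unfolding D_def by (rule large_sieve_one_character_per_prime[OF \<chi> assms(2)])
      finally show ?thesis by simp
    qed
    have "(\<Sum>i\<in>?B. \<Sum>p\<in>?S. norm (\<Sum>n\<in>I j i. \<chi> p (int n)) ^ (2 * k))
        \<le> (\<Sum>i\<in>?B. D * (\<Sum>n=1..M. real (a j i n) ^ 2))"
      by (rule sum_mono) (rule block)
    also have "\<dots> = D * (\<Sum>i\<in>?B. \<Sum>n=1..M. real (a j i n) ^ 2)"
      by (simp only: sum_distrib_left)
    also have "\<dots> = D * (\<Sum>n=1..M. \<Sum>i\<in>?B. real (a j i n) ^ 2)"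
      by (subst sum.swap) (rule refl)
    also have "\<dots> \<le> D * (\<Sum>n=1..M. real (divisor_count n) ^ (2 * k))"
    proof (intro mult_left_mono sum_mono D0)
      fix n assume n: "n \<in> {1..M}"
      have "(\<Sum>i\<in>?B. a j i n) \<le> divisor_count n ^ k"
        unfolding a_def using n assms(3)
        by (intro sum_card_factorizations_in_le disj) (auto simp: I_def)
      hence "real (\<Sum>i\<in>?B. a j i n) \<le> real (divisor_count n ^ k)" by (rule of_nat_mono)
      hence "(\<Sum>i\<in>?B. real (a j i n)) ^ 2 \<le> (real (divisor_count n) ^ k) ^ 2"
        by (intro power_mono sum_nonneg) auto
      moreover have "(\<Sum>i\<in>?B. real (a j i n) ^ 2) \<le> (\<Sum>i\<in>?B. real (a j i n)) ^ 2"
        by (rule sum_power2_le_power2_sum) auto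
      ultimately show "(\<Sum>i\<in>?B. real (a j i n) ^ 2) \<le> real (divisor_count n) ^ (2 * k)"
        by (simp only: power_mult[symmetric] mult.commute[of k])
    qed
    also have "\<dots> \<le> D * W"
      unfolding W_def by (intro mult_left_mono sum_divisor_count_power_le M0 D0)
    finally show ?thesis .
  qed
  have "(\<Sum>p\<in>?S. norm (\<Sum>n<L p. \<chi> p (int n)) ^ (2 * k))
      \<le> (\<Sum>p\<in>?S. real (Suc K) ^ (2 * k) *
          (\<Sum>j\<le>K. \<Sum>i<2 ^ (Suc K - j). norm (\<Sum>n\<in>I j i. \<chi> p (int n)) ^ (2 * k)))"
    unfolding I_def using L by (intro sum_mono dyadic_block_decomposition) blast
  also have "\<dots> = real (Suc K) ^ (2 * k) *
      (\<Sum>p\<in>?S. \<Sum>j\<le>K. \<Sum>i<2 ^ (Suc K - j). norm (\<Sum>n\<in>I j i. \<chi> p (int n)) ^ (2 * k))"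
    by (simp only: sum_distrib_left)
  also have "(\<Sum>p\<in>?S. \<Sum>j\<le>K. \<Sum>i<2 ^ (Suc K - j). norm (\<Sum>n\<in>I j i. \<chi> p (int n)) ^ (2 * k))
      = (\<Sum>j\<le>K. \<Sum>p\<in>?S. \<Sum>i<2 ^ (Suc K - j). norm (\<Sum>n\<in>I j i. \<chi> p (int n)) ^ (2 * k))"
    by (rule sum.swap)
  also have "\<dots> = (\<Sum>j\<le>K. \<Sum>i<2 ^ (Suc K - j). \<Sum>p\<in>?S. norm (\<Sum>n\<in>I j i. \<chi> p (int n)) ^ (2 * k))"
    by (rule sum.cong[OF refl]) (rule sum.swap)
  \<comment> \<open>Each of the K + 1 levels costs the same \<open>D * W\<close>, which raises the
    exponent of \<open>Suc K\<close> to 2k + 1.\<close>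
  also have "real (Suc K) ^ (2 * k) * \<dots> \<le> real (Suc K) ^ (2 * k) * (\<Sum>j\<le>K. D * W)"
    using level by (intro mult_left_mono sum_mono) auto
  also have "\<dots> = real (Suc K) ^ (2 * k + 1) * D * W"
    by (simp add: mult_ac)
  finally show ?thesis unfolding D_def W_def .
qed

section \<open>Absorbing constants and logarithms into the o(1) exponent\<close>

lemma ln_over_ln_tendsto_0:
  fixes A B :: real
  shows "(\<lambda>n. (A + B * ln (1 + ln (real n))) / ln (real n)) \<longlonglongrightarrow> 0"
proof -
  have top: "filterlim (\<lambda>n. ln (real n)) at_top sequentially"
    by (rule filterlim_compose[OF ln_at_top filterlim_real_sequentially])
  have top1: "filterlim (\<lambda>x::real. 1 + x) at_top at_top"
    by (rule filterlim_tendsto_add_at_top[OF tendsto_const filterlim_ident])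
  have "((\<lambda>x::real. ln x / x) \<longlongrightarrow> 0) at_top" by (rule ln_x_over_x_tendsto_0)
  from filterlim_compose[OF this top1] have 1: "((\<lambda>x::real. ln (1 + x) / (1 + x)) \<longlongrightarrow> 0) at_top" .
  have 2: "((\<lambda>x::real. 1 / x) \<longlongrightarrow> 0) at_top"
    by (rule tendsto_divide_0[OF tendsto_const]) (rule filterlim_at_top_imp_at_infinity[OF filterlim_ident])
  have "((\<lambda>x::real. A * (1 / x) + B * (ln (1 + x) / (1 + x) * (1 + 1 / x))) \<longlongrightarrow> A * 0 + B * (0 * (1 + 0))) at_top"
    by (intro tendsto_intros 1 2)
  moreover have "eventually (\<lambda>x::real. A * (1 / x) + B * (ln (1 + x) / (1 + x) * (1 + 1 / x))
      = (A + B * ln (1 + x)) / x) at_top"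
    using eventually_gt_at_top[of 0] by eventually_elim (simp add: divide_simps, simp add: algebra_simps)
  ultimately have "((\<lambda>x::real. (A + B * ln (1 + x)) / x) \<longlongrightarrow> 0) at_top"
    by (auto dest: Lim_transform_eventually)
  from filterlim_compose[OF this top] show ?thesis .
qed

text \<open>Every logarithm is compared with \<Lambda>. Its exponent collects 2k + 1 from the dyadic
  levels, 1 from Polya-Vinogradov and 2^(2k) from the divisor moment. The condition N <= P^2
  converts logarithms of N into logarithms of P.\<close>

lemma moment_bound_simplify:
  fixes P N :: nat
  assumes "P \<ge> 2" "N > 0" "N \<le> P ^ 2" "k > 0" and K: "2 ^ K \<le> 2 * N + 1"
  defines "M \<equiv> (2 ^ Suc K) ^ k" and "\<Lambda> \<equiv> 1 + ln (real P)"
  shows "real (Suc K) ^ (2 * k + 1) * (real M + 4 * real P ^ 3 * (1 + 4 * ln (2 * real P)))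
       * (real M * (1 + ln (real M)) ^ (2 ^ (2 * k)))
    \<le> (5 ^ (2 * k + 1) * 20 * 6 ^ k * 6 ^ k * (6 * real k) ^ (2 ^ (2 * k))) * \<Lambda> ^ (2 * k + 2 + 2 ^ (2 * k))
       * (real P ^ 3 + real N ^ k) * real N ^ k"
proof -
  have lnP: "ln (real P) \<ge> 0" using assms(1) by simp
  have \<Lambda>1: "\<Lambda> \<ge> 1" using lnP by (simp add: \<Lambda>_def)
  have ln2: "1 / 2 \<le> ln (2::real)" "ln (2::real) \<le> 1"
    using ln_le_minus_one[of "1 / 2 :: real"] ln_le_minus_one[of "2::real"] by (simp_all add: ln_div)
  have "real K * ln 2 = ln (2 ^ K)" by (simp add: ln_realpow)
  also have "(2::real) ^ K \<le> 3 * real P ^ 2"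
  proof -
    have "2 ^ K \<le> 3 * P ^ 2" using K assms(2,3) by linarith
    hence "real (2 ^ K) \<le> real (3 * P ^ 2)" by (rule of_nat_mono)
    thus ?thesis by simp
  qed
  hence "ln ((2::real) ^ K) \<le> ln (3 * real P ^ 2)" by (intro ln_mono) auto
  also have "ln (3 * real P ^ 2) = ln 3 + 2 * ln (real P)"
    using assms(1) by (simp add: ln_mult ln_realpow)
  also have "ln (3::real) \<le> 2" using ln_le_minus_one[of "3::real"] by simp
  finally have "real K * ln 2 \<le> 2 + 2 * ln (real P)" by simp
  moreover have "real K * (1 / 2) \<le> real K * ln 2" using ln2 by (intro mult_left_mono) auto
  \<comment> \<open>From K/2 <= 2 + 2 ln P one gets K + 1 <= 5 + 4 ln P.\<close>
  ultimately have SK: "real (Suc K) \<le> 5 * \<Lambda>" using lnP by (simp add: \<Lambda>_def)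
  have lnB: "1 + 4 * ln (2 * real P) \<le> 5 * \<Lambda>"
  proof -
    have "ln (2 * real P) = ln 2 + ln (real P)" using assms(1) by (simp add: ln_mult)
    also have "\<dots> \<le> \<Lambda>" using ln2(2) by (simp add: \<Lambda>_def)
    finally have "ln (2 * real P) \<le> \<Lambda>" .
    thus ?thesis using \<Lambda>1 by simp
  qed
  have MN: "real M \<le> 6 ^ k * real N ^ k"
  proof -
    \<comment> \<open>The factor 6 comes from 2(2N + 1) <= 6N.\<close>
    have "(2::nat) ^ Suc K \<le> 6 * N" using K assms(2) by simp
    hence "M \<le> (6 * N) ^ k" unfolding M_def by (rule power_mono) simp
    hence "real M \<le> real ((6 * N) ^ k)" by (rule of_nat_mono)
    thus ?thesis by (simp add: power_mult_distrib)
  qed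
  have "ln (real M) = real k * (real (Suc K) * ln 2)"
    unfolding M_def by (simp add: ln_realpow del: power_Suc of_nat_Suc)
  also have "\<dots> \<le> real k * (5 * \<Lambda> * 1)"
    using SK ln2 \<Lambda>1 by (intro mult_left_mono mult_mono) auto
  finally have "1 + ln (real M) \<le> 1 * 1 + real k * (5 * \<Lambda>)" by simp
  also have "\<dots> \<le> real k * \<Lambda> + real k * (5 * \<Lambda>)"
    using \<Lambda>1 assms(4) by (intro add_right_mono mult_mono) auto
  finally have lnM: "1 + ln (real M) \<le> 6 * real k * \<Lambda>" by (simp add: mult_ac)
  have "M > 0" by (simp add: M_def)
  hence M1: "real M \<ge> 1" by simp
  have D: "real M + 4 * real P ^ 3 * (1 + 4 * ln (2 * real P)) \<le> 20 * 6 ^ k * \<Lambda> * (real P ^ 3 + real N ^ k)"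
  proof -
    have "real M \<le> (20 * 6 ^ k * \<Lambda>) * real N ^ k"
    proof -
      have "(1 * 6 ^ k) * 1 \<le> (20 * 6 ^ k) * \<Lambda>" using \<Lambda>1 by (intro mult_mono) auto
      hence "6 ^ k * real N ^ k \<le> (20 * 6 ^ k * \<Lambda>) * real N ^ k" by (intro mult_right_mono) auto
      with MN show ?thesis by linarith
    qed
    moreover have "4 * real P ^ 3 * (1 + 4 * ln (2 * real P)) \<le> (20 * 6 ^ k * \<Lambda>) * real P ^ 3"
    proof -
      have "4 * real P ^ 3 * (1 + 4 * ln (2 * real P)) \<le> 4 * real P ^ 3 * (5 * \<Lambda>)"
        using lnB by (intro mult_left_mono) auto
      also have "\<dots> = 1 * (20 * \<Lambda> * real P ^ 3)" by simp
      also have "\<dots> \<le> 6 ^ k * (20 * \<Lambda> * real P ^ 3)"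
        using \<Lambda>1 by (intro mult_right_mono) auto
      finally show ?thesis by (simp only: mult_ac)
    qed
    ultimately show ?thesis by (simp only: distrib_left)
  qed
  have "real (Suc K) ^ (2 * k + 1) * (real M + 4 * real P ^ 3 * (1 + 4 * ln (2 * real P)))
       * (real M * (1 + ln (real M)) ^ (2 ^ (2 * k)))
    \<le> (5 * \<Lambda>) ^ (2 * k + 1) * (20 * 6 ^ k * \<Lambda> * (real P ^ 3 + real N ^ k))
       * ((6 ^ k * real N ^ k) * (6 * real k * \<Lambda>) ^ (2 ^ (2 * k)))"
  proof (rule mult_mono)
    show "real (Suc K) ^ (2 * k + 1) * (real M + 4 * real P ^ 3 * (1 + 4 * ln (2 * real P)))
        \<le> (5 * \<Lambda>) ^ (2 * k + 1) * (20 * 6 ^ k * \<Lambda> * (real P ^ 3 + real N ^ k))"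
    proof (rule mult_mono)
      show "real (Suc K) ^ (2 * k + 1) \<le> (5 * \<Lambda>) ^ (2 * k + 1)" using SK by (rule power_mono) simp
    qed (use D \<Lambda>1 lnP assms(1) in auto)
    show "real M * (1 + ln (real M)) ^ (2 ^ (2 * k)) \<le> (6 ^ k * real N ^ k) * (6 * real k * \<Lambda>) ^ (2 ^ (2 * k))"
    proof (rule mult_mono)
      show "(1 + ln (real M)) ^ (2 ^ (2 * k)) \<le> (6 * real k * \<Lambda>) ^ (2 ^ (2 * k))"
        using lnM M1 by (intro power_mono) auto
    qed (use MN M1 in auto)
  qed (use \<Lambda>1 M1 in auto)
  also have "\<dots> = (5 ^ (2 * k + 1) * 20 * 6 ^ k * 6 ^ k * (6 * real k) ^ (2 ^ (2 * k))) * \<Lambda> ^ (2 * k + 2 + 2 ^ (2 * k))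
       * (real P ^ 3 + real N ^ k) * real N ^ k"
    unfolding power_mult_distrib power_add by (simp add: mult_ac power2_eq_square)
  finally show ?thesis .
qed

theorem mainTheorem8:
  fixes \<nu> :: nat
  assumes "\<nu> \<ge> 1"
  shows "\<exists>\<epsilon> :: nat \<Rightarrow> real. \<epsilon> \<longlonglongrightarrow> 0 \<and>
    (\<exists>P\<^sub>0 N\<^sub>0 :: nat. \<forall>P N :: nat. \<forall>Np :: nat \<Rightarrow> nat.
      P > 0 \<and> N > 0 \<and> P \<ge> P\<^sub>0 \<and> N \<ge> N\<^sub>0 \<and> N \<le> P ^ 2 \<and>
      (\<forall>p. prime p \<and> P < p \<and> p \<le> 2 * P \<longrightarrow> N < Np p \<and> Np p \<le> 2 * N) \<longrightarrow>
      (\<Sum>p | prime p \<and> P < p \<and> p \<le> 2 * P.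
         Max ((\<lambda>\<chi>. cmod (\<Sum>n = 1..Np p. \<chi> (int n)) ^ (2 * \<nu>)) ` primitive_characters (p ^ 2)))
      \<le> (real P ^ 3 + real N ^ \<nu>
          + min (real N ^ \<nu> * real P powr (1 / 2)) (real N powr (real \<nu> / 2) * real P ^ 2))
        * real N ^ \<nu> * real P powr \<epsilon> P)"
proof -
  define C where "C = (5 ^ (2 * \<nu> + 1) * 20 * 6 ^ \<nu> * 6 ^ \<nu> * (6 * real \<nu>) ^ (2 ^ (2 * \<nu>)) :: real)"
  define A where "A = 2 * \<nu> + 2 + 2 ^ (2 * \<nu>)"
  \<comment> \<open>Chosen so that P^\<epsilon>(P) equals C (1 + ln P)^A exactly for P >= 2; it
    depends only on P and \<nu>, which gives the required uniformity.\<close>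
  define \<epsilon> where "\<epsilon> = (\<lambda>n. (ln C + real A * ln (1 + ln (real n))) / ln (real n))"
  have "C > 0" using assms by (simp add: C_def)
  have lim: "\<epsilon> \<longlonglongrightarrow> 0" unfolding \<epsilon>_def by (rule ln_over_ln_tendsto_0)
  have powr_\<epsilon>: "real P powr \<epsilon> P = C * (1 + ln (real P)) ^ A" if "P \<ge> 2" for P :: nat
  proof -
    have "ln (real P) > 0" using that by simp
    hence "\<epsilon> P * ln (real P) = ln (C * (1 + ln (real P)) ^ A)"
      using \<open>C > 0\<close> by (simp add: \<epsilon>_def ln_mult ln_realpow)
    moreover have "C * (1 + ln (real P)) ^ A > 0"
      using \<open>C > 0\<close> \<open>ln (real P) > 0\<close> by simp
    ultimately show ?thesis using that by (simp add: powr_def)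
  qed
  have main: "(\<Sum>p | prime p \<and> P < p \<and> p \<le> 2 * P.
         Max ((\<lambda>\<chi>. cmod (\<Sum>n = 1..Np p. \<chi> (int n)) ^ (2 * \<nu>)) ` primitive_characters (p ^ 2)))
      \<le> (real P ^ 3 + real N ^ \<nu>
          + min (real N ^ \<nu> * real P powr (1 / 2)) (real N powr (real \<nu> / 2) * real P ^ 2))
        * real N ^ \<nu> * real P powr \<epsilon> P"
    if P: "P \<ge> 2" and N: "N > 0" "N \<le> P ^ 2"
      and Np: "\<And>p. prime p \<Longrightarrow> P < p \<Longrightarrow> p \<le> 2 * P \<Longrightarrow> Np p \<le> 2 * N" for P N :: nat and Np
  proof -
    let ?S = "{p. prime p \<and> P < p \<and> p \<le> 2 * P}"
    define F where "F = (\<lambda>p \<chi>. cmod (\<Sum>n = 1..Np p. \<chi> (int n)) ^ (2 * \<nu>))"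
    \<comment> \<open>The maximum is attained over a finite nonempty set, so one extremal character
      can be fixed for each prime.\<close>
    have "\<exists>\<chi>\<in>primitive_characters (p ^ 2). Max (F p ` primitive_characters (p ^ 2)) = F p \<chi>" if "prime p" for p
    proof -
      have "Max (F p ` primitive_characters (p ^ 2)) \<in> F p ` primitive_characters (p ^ 2)"
        using primitive_characters_prime_square_nonempty[OF that] finite_primitive_characters[of "p ^ 2"]
          prime_gt_0_nat[OF that] by (intro Max_in) auto
      thus ?thesis by auto
    qed
    then obtain \<chi> where \<chi>: "\<chi> p \<in> primitive_characters (p ^ 2)"
        "Max (F p ` primitive_characters (p ^ 2)) = F p (\<chi> p)" if "prime p" for p
      by metis
    \<comment> \<open>The upper bound covers every length Np(p) + 1 <= 2N + 1, the extra 1 coming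
      from starting sums at n = 0; the lower bound keeps 2^K of order N.\<close>
    obtain K where K: "2 ^ K \<le> 2 * N + 1" "2 * N + 1 < 2 ^ (K + 1)"
      using ex_power_ivl1[of 2 "2 * N + 1"] by auto
    have "(\<Sum>p\<in>?S. Max (F p ` primitive_characters (p ^ 2)))
        = (\<Sum>p\<in>?S. norm (\<Sum>n<Suc (Np p). \<chi> p (int n)) ^ (2 * \<nu>))"
    proof (rule sum.cong[OF refl])
      fix p assume "p \<in> ?S"
      hence p: "prime p" by simp
      have "p ^ 2 > 1" using prime_gt_1_nat[OF p] by (intro one_less_power) auto
      moreover have "dirichlet_character (p ^ 2) (\<chi> p)"
        using \<chi>(1)[OF p] by (simp add: primitive_characters_def)
      ultimately have "\<chi> p 0 = 0" using dirichlet_character_0 by blast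
      hence "(\<Sum>n=1..Np p. \<chi> p (int n)) = (\<Sum>n<Suc (Np p). \<chi> p (int n))"
        by (intro sum.mono_neutral_left) (auto simp: not_less_eq_eq less_Suc_eq_le)
      thus "Max (F p ` primitive_characters (p ^ 2)) = norm (\<Sum>n<Suc (Np p). \<chi> p (int n)) ^ (2 * \<nu>)"
        unfolding \<chi>(2)[OF p] by (simp only: F_def)
    qed
    also have "\<dots> \<le> real (Suc K) ^ (2 * \<nu> + 1)
        * (real ((2 ^ Suc K) ^ \<nu>) + 4 * real P ^ 3 * (1 + 4 * ln (2 * real P)))
        * (real ((2 ^ Suc K) ^ \<nu>) * (1 + ln (real ((2 ^ Suc K) ^ \<nu>))) ^ (2 ^ (2 * \<nu>)))"
    proof (rule moment_one_character_per_prime)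
      fix p assume "prime p" "P < p" "p \<le> 2 * P"
      from Np[OF this] show "Suc (Np p) < 2 ^ Suc K" using K(2) by simp
    qed (use \<chi>(1) P assms in auto)
    also have "\<dots> \<le> C * (1 + ln (real P)) ^ A * (real P ^ 3 + real N ^ \<nu>) * real N ^ \<nu>"
      unfolding C_def A_def using P N assms K(1) by (intro moment_bound_simplify) auto
    also have "\<dots> = (real P ^ 3 + real N ^ \<nu>) * (real N ^ \<nu> * real P powr \<epsilon> P)"
      by (simp only: powr_\<epsilon>[OF P] mult_ac)
    \<comment> \<open>The minimum is nonnegative, so adding it only enlarges the bound.\<close>
    also have "\<dots> \<le> (real P ^ 3 + real N ^ \<nu>
          + min (real N ^ \<nu> * real P powr (1 / 2)) (real N powr (real \<nu> / 2) * real P ^ 2))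
        * (real N ^ \<nu> * real P powr \<epsilon> P)"
      by (intro mult_right_mono) auto
    finally show ?thesis by (simp only: F_def mult.assoc)
  qed
  show ?thesis
    using lim main by (intro exI[of _ \<epsilon>] exI[of _ 2] exI[of _ 0]) blast
qed

end
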